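(* For $\mathfrak g=A_2$ and every $\lambda\in R$ (i.e. $\lambda\in\mathfrak h^*_{\mathbb R}$ lying on no vanishing line $P(n,\alpha)$), the normalized signature character of the Verma module $V(\lambda)$ is $\sigma(\lambda)=f(\lambda)=\tilde f(a_1(\lambda),a_2(\lambda),a_3(\lambda))/\big((1-x_1^2)(1-x_2^2)(1-x_1^2x_2^2)\big)$.
   Context: $\mathfrak g=A_2$ with simple roots $\alpha_1,\alpha_2$, $(\alpha_1,\alpha_1)=(\alpha_2,\alpha_2)=2$, $(\alpha_1,\alpha_2)=-1$, $\alpha_3=\alpha_1+\alpha_2$, $\Delta_+=\{\alpha_1,\alpha_2,\alpha_3\}$, $\rho=\alpha_3$; $\mathfrak h^*_{\mathbb R}$ is the real span of $\alpha_1,\alpha_2$. Vanishing lines: $P(n,\alpha)=\{\lambda:(\alpha,\lambda+\rho)=n\}$, $n\in\mathbb Z_{\ge1}$, $\alpha\in\Delta_+$. For $\lambda\in\mathfrak h^*_{\mathbb R}$, $V(\lambda)$ is the Verma module with highest weight vector $|\lambda\rangle$; the Shapovalov form is the unique bilinear form with $\langle\lambda|\lambda\rangle=1$, $\langle x\lambda,y\lambda\rangle=\langle\lambda,x^\dagger y\lambda\rangle$, where $\dagger$ is the anti-automorphism with $H_i^\dagger=H_i$, $E_{\pm\alpha_i}^\dagger=E_{\mp\alpha_i}$. For $m_1,m_2\ge0$ let $M_{(m_1,m_2)}(\lambda)$ be its real symmetric Gram matrix on the weight space of weight $\lambda-m_1\alpha_1-m_2\alpha_2$, and define $\sigma(\lambda)=\sum_{m_1,m_2\ge0}{\rm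 sig}(M_{(m_1,m_2)}(\lambda))x_1^{m_1}x_2^{m_2}$, sig being (#positive − #negative eigenvalues). Put $a_i(\lambda)=\max(0,\lfloor(\alpha_i,\lambda+\rho)\rfloor)$ for $i=1,2,3$ and $\tilde f(a_1,a_2,a_3)=(1+x_1)(1+x_2)(1+x_1x_2)-2x_1^{a_1+1}(1+x_2)(1+x_1x_2)-2x_2^{a_2+1}(1+x_1)(1+x_1x_2)-2(x_1x_2)^{a_3+1}(1+x_1)(1+x_2)+4x_1^{a_1+1}(x_1x_2)^{\min(a_2,a_3)+1}(1+x_2)+4x_2^{a_2+1}(x_1x_2)^{\min(a_1,a_3)+1}(1+x_1)+4x_1^{\max(a_1,a_3)+1}x_2^{\max(a_2,a_3)+1}(1+x_1x_2)-8x_1^{\min(a_2,a_3)+a_1+2}x_2^{\min(a_1,a_3)+a_2+2}$. *)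

theory Defs
  imports "Jordan_Normal_Form.Char_Poly" "HOL-Computational_Algebra.Formal_Power_Series"
begin

text \<open>A weight lambda in the real span of alpha1, alpha2 is represented by its
coordinates (c1, c2), i.e. lambda = c1 alpha1 + c2 alpha2.  Positive roots are
indexed by 1, 2, 3 with alpha3 = alpha1 + alpha2.  The form has
(alpha1,alpha1) = (alpha2,alpha2) = 2, (alpha1,alpha2) = -1.\<close>

type_synonym wt = "real \<times> real"

definition A2_form :: "wt \<Rightarrow> wt \<Rightarrow> real" where
  "A2_form a b = 2 * fst a * fst b - fst a * snd b - snd a * fst b + 2 * snd a * snd b"

definition A2_root :: "nat \<Rightarrow> wt" where
  "A2_root i = (if i = 1 then (1, 0) else if i = 2 then (0, 1) else (1, 1))"

definition A2_pos_roots :: "nat set" where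
  "A2_pos_roots = {1, 2, 3}"

definition A2_rho :: wt where
  "A2_rho = (1, 1)"

definition wt_add :: "wt \<Rightarrow> wt \<Rightarrow> wt" where
  "wt_add a b = (fst a + fst b, snd a + snd b)"

definition vanishing_line :: "nat \<Rightarrow> nat \<Rightarrow> wt set" where
  "vanishing_line n i = {lam. A2_form (A2_root i) (wt_add lam A2_rho) = real n}"

definition regR :: "wt set" where
  "regR = {lam. \<forall>n i. n \<ge> 1 \<longrightarrow> i \<in> A2_pos_roots \<longrightarrow> lam \<notin> vanishing_line n i}"

definition a_coord :: "nat \<Rightarrow> wt \<Rightarrow> nat" where
  "a_coord i lam = nat \<lfloor>A2_form (A2_root i) (wt_add lam A2_rho)\<rfloor>"

text \<open>A word w = [j1,...,jk] (entries 1 or 2) stands for the vector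
F_{j1} ... F_{jk} |lambda> of V(lambda), where F_j = E_{-alpha_j}.
Its weight is lambda minus the sum of the alpha_{j}.\<close>

definition word_wt :: "wt \<Rightarrow> nat list \<Rightarrow> wt" where
  "word_wt lam w = (fst lam - real (count_list w 1), snd lam - real (count_list w 2))"

text \<open>E_i F_{v1} ... F_{vk} |lambda> =
  sum over positions p with v_p = i of (alpha_i, lambda - wt(v_{p+1} ... v_k)) times
  F_{v1} .. (v_p omitted) .. F_{vk} |lambda>, using [E_i,F_j] = delta_ij H_i,
  H_i acting on weight mu by (alpha_i, mu), and E_i |lambda> = 0.
  The Shapovalov form satisfies <F_i u lambda, v lambda> = <u lambda, E_i v lambda>
  (since F_i^dagger = E_i) and <lambda, w lambda> = 0 for nonempty w (weight reasons),
  <lambda|lambda> = 1; this determines it on words recursively:\<close>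

fun shap :: "wt \<Rightarrow> nat list \<Rightarrow> nat list \<Rightarrow> real" where
  "shap lam [] v = (if v = [] then 1 else 0)"
| "shap lam (i # u) v =
     (\<Sum>p<length v. if v ! p = i
        then A2_form (A2_root i) (word_wt lam (drop (Suc p) v))
             * shap lam u (take p v @ drop (Suc p) v)
        else 0)"

text \<open>Linear combinations of words (elements of U(n^-) applied to |lambda>).\<close>
type_synonym lc = "(real \<times> nat list) list"

definition lc_prod :: "lc \<Rightarrow> lc \<Rightarrow> lc" where
  "lc_prod xs ys = [(fst x * fst y, snd x @ snd y). x \<leftarrow> xs, y \<leftarrow> ys]"

fun lc_pow :: "lc \<Rightarrow> nat \<Rightarrow> lc" where
  "lc_pow xs 0 = [(1, [])]"
| "lc_pow xs (Suc n) = lc_prod xs (lc_pow xs n)"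

definition shap_lc :: "wt \<Rightarrow> lc \<Rightarrow> lc \<Rightarrow> real" where
  "shap_lc lam xs ys = (\<Sum>x\<leftarrow>xs. \<Sum>y\<leftarrow>ys. fst x * fst y * shap lam (snd x) (snd y))"

text \<open>F_3 := [F_1, F_2] (a nonzero multiple of E_{-alpha3}); PBW basis vectors
F_1^a F_3^b F_2^c |lambda>.\<close>
definition F3_lc :: lc where
  "F3_lc = [(1, [1, 2]), (-1, [2, 1])]"

definition pbw :: "nat \<Rightarrow> nat \<Rightarrow> nat \<Rightarrow> lc" where
  "pbw a b c = lc_prod (lc_pow [(1, [1])] a) (lc_prod (lc_pow F3_lc b) (lc_pow [(1, [2])] c))"

text \<open>The weight space of weight lambda - m1 alpha1 - m2 alpha2 has PBW basis
F_1^(m1-b) F_3^b F_2^(m2-b) |lambda>, b = 0..min m1 m2.\<close>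
definition gram :: "wt \<Rightarrow> nat \<Rightarrow> nat \<Rightarrow> real mat" where
  "gram lam m1 m2 = mat (Suc (min m1 m2)) (Suc (min m1 m2))
     (\<lambda>(i, j). shap_lc lam (pbw (m1 - i) i (m2 - i)) (pbw (m1 - j) j (m2 - j)))"

definition n_pos_eig :: "real mat \<Rightarrow> nat" where
  "n_pos_eig A = (\<Sum>x\<in>{x. x > 0 \<and> eigenvalue A x}. order x (char_poly A))"

definition n_neg_eig :: "real mat \<Rightarrow> nat" where
  "n_neg_eig A = (\<Sum>x\<in>{x. x < 0 \<and> eigenvalue A x}. order x (char_poly A))"

definition sig :: "real mat \<Rightarrow> int" where
  "sig A = int (n_pos_eig A) - int (n_neg_eig A)"

text \<open>Z[[x1,x2]] is modelled as (int fps) fps: x2 is the outer variable, x1 the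
inner one; the coefficient of x1^m1 x2^m2 in S is (S $ m2) $ m1.\<close>

definition X1 :: "int fps fps" where "X1 = fps_const fps_X"
definition X2 :: "int fps fps" where "X2 = fps_X"

definition sig_char :: "wt \<Rightarrow> int fps fps" where
  "sig_char lam = Abs_fps (\<lambda>m2. Abs_fps (\<lambda>m1. sig (gram lam m1 m2)))"

definition ftilde :: "nat \<Rightarrow> nat \<Rightarrow> nat \<Rightarrow> int fps fps" where
  "ftilde a1 a2 a3 =
     (1 + X1) * (1 + X2) * (1 + X1 * X2)
   - 2 * X1 ^ (a1 + 1) * (1 + X2) * (1 + X1 * X2)
   - 2 * X2 ^ (a2 + 1) * (1 + X1) * (1 + X1 * X2)
   - 2 * (X1 * X2) ^ (a3 + 1) * (1 + X1) * (1 + X2)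
   + 4 * X1 ^ (a1 + 1) * (X1 * X2) ^ (min a2 a3 + 1) * (1 + X2)
   + 4 * X2 ^ (a2 + 1) * (X1 * X2) ^ (min a1 a3 + 1) * (1 + X1)
   + 4 * X1 ^ (max a1 a3 + 1) * X2 ^ (max a2 a3 + 1) * (1 + X1 * X2)
   - 8 * X1 ^ (min a2 a3 + a1 + 2) * X2 ^ (min a1 a3 + a2 + 2)"

definition A2_denom :: "int fps fps" where
  "A2_denom = (1 - X1 ^ 2) * (1 - X2 ^ 2) * (1 - X1 ^ 2 * X2 ^ 2)"

end

theory Submission
  imports Defs "HOL-Computational_Algebra.Fundamental_Theorem_Algebra"
begin

text \<open>Put \<open>t\<^sub>i = (\<alpha>\<^sub>i, \<lambda> + \<rho>)\<close>. When \<open>t\<^sub>1\<close> is not an integer, \<open>V(\<lambda>)\<close> is semisimple over the copy of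
\<open>gl\<^sub>2\<close> generated by \<open>E\<^sub>1\<close> and \<open>F\<^sub>1\<close>, and the resulting Gelfand--Tsetlin basis is orthogonal for the
Shapovalov form, unitriangular with respect to the PBW basis, and has norms that are explicit products
of linear factors. Hence the Gram matrix is congruent to the diagonal matrix of these norms, and the
signature is a sum of explicit signs. The product of the norms is the determinant of the Gram matrix;
after cancellation its only zeros are on the vanishing lines, so for \<open>\<lambda>\<close> off these lines with
integral \<open>t\<^sub>1\<close> the signature is that of a nearby weight with non-integral \<open>t\<^sub>1\<close>. Peeling off the
terms with \<open>b = 0\<close> (if \<open>t\<^sub>1 \<ge> 0\<close>) or \<open>c = 0\<close> (if \<open>t\<^sub>1 < 0\<close>) of the sum of signs over the basis
vectors indexed by \<open>(a, b, c)\<close> gives recursions in the floors of the \<open>t\<^sub>i\<close>, and the stated rational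
function satisfies the same recursions.\<close>

section \<open>The signature of a real symmetric matrix\<close>

text \<open>The form is given only by a recursion on words, so the Gelfand--Tsetlin picture enters
  as explicit operators on coordinates. Two facts tie it to the recursion: the operators satisfy
  [E_i, F_j] = delta_ij H_i, and E_i, F_i are adjoint for the diagonal form. The obstacle is that
  these coordinates have poles at integral \<open>t1\<close>, whereas the Gram matrix is polynomial
  in the weight. When \<open>t1\<close> is moved to a nearby non-integral value the Gram entries
  stay close, but the change of basis may blow up. The law of inertia is therefore proved in a form
  that bounds neither the basis nor the norms and asks only for fixed signs and entrywise closeness.
  The move is to the right, where floors are constant, and keeps \<open>t2\<close> fixed. The
  induction on the floors has a circular bottom: at floor 0 of \<open>t1\<close> the row recursion
  leads to floor -1 and the column recursion leads back to 0. Each loop lowers the other two floors,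
  and once these are truncated to 0 it becomes a linear equation for a single power series, with a
  cancellable coefficient.\<close>

lemma order_prod_linear:
  "order (x::real) (\<Prod>a\<leftarrow>as. [:- a, 1:]) = count_list as x"
proof (induction as)
  case (Cons a as)
  have nz: "(\<Prod>a\<leftarrow>as. [:- a, 1:]) \<noteq> 0" by (simp add: prod_list_zero_iff image_iff)
  have "order x [:- a, 1:] = (if a = x then 1 else 0)"
    using order_power_n_n[of x 1] by (auto simp: order_0I)
  moreover have "order x ([:- a, 1:] * (\<Prod>a\<leftarrow>as. [:- a, 1:])) = order x [:- a, 1:] + order x (\<Prod>a\<leftarrow>as. [:- a, 1:])"
    using nz by (intro order_mult) (simp del: mult_pCons_left)
  ultimately show ?case using Cons by (simp del: mult_pCons_left)
qed (simp add: order_0I)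

lemma sum_count_list_filter:
  "(\<Sum>x\<in>{x. P x \<and> x \<in> set xs}. count_list xs x) = length (filter P xs)"
proof -
  have "(\<Sum>x\<in>{x. P x \<and> x \<in> set xs}. count_list xs x) = (\<Sum>x\<in>{x. P x \<and> x \<in> set xs}. count_list (filter P xs) x)"
  proof (rule sum.cong)
    have "count_list xs x = count_list (filter P xs) x" if "P x" for x
      using that by (induction xs) auto
    then show "count_list xs x = count_list (filter P xs) x" if "x \<in> {x. P x \<and> x \<in> set xs}" for x
      using that by blast
  qed simp
  also have "\<dots> = length (filter P xs)" by (rule sum_count_set) auto
  finally show ?thesis .
qed

lemma sig_char_poly_linear:
  assumes A: "A \<in> carrier_mat n n" and cp: "char_poly A = (\<Prod>a\<leftarrow>as. [:- a, 1:])"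
  shows "sig A = int (length (filter (\<lambda>x. x > 0) as)) - int (length (filter (\<lambda>x. x < 0) as))"
proof -
  have "eigenvalue A x \<longleftrightarrow> x \<in> set as" for x
    unfolding eigenvalue_root_char_poly[OF A] cp by (auto simp: poly_prod_list prod_list_zero_iff image_iff)
  then show ?thesis
    unfolding sig_def n_pos_eig_def n_neg_eig_def cp order_prod_linear by (simp add: sum_count_list_filter)
qed

section \<open>The spectral theorem for real symmetric matrices\<close>

lemma symmetric_real_eigenvalue:
  fixes A :: "real mat"
  assumes A: "A \<in> carrier_mat n n" and sym: "transpose_mat A = A" and "n > 0"
  shows "\<exists>e. eigenvalue A e"
proof -
  let ?c = complex_of_real
  have poly_of_real: "poly (map_poly ?c p) (?c x) = ?c (poly p x)" for p x
    by (induction p) (auto simp: map_poly_pCons)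
  let ?A = "map_mat ?c A"
  have A': "?A \<in> carrier_mat n n" using A by simp
  have "degree (char_poly ?A) \<noteq> 0" using degree_monic_char_poly[OF A'] \<open>n > 0\<close> by simp
  then obtain z where "poly (char_poly ?A) z = 0"
    using fundamental_theorem_of_algebra[of "char_poly ?A"] constant_degree[of "char_poly ?A"] by auto
  then obtain v where v: "v \<in> carrier_vec n" "v \<noteq> 0\<^sub>v n" "?A *\<^sub>v v = z \<cdot>\<^sub>v v"
    using eigenvalue_root_char_poly[OF A'] A unfolding eigenvalue_def eigenvector_def by auto
  have Av: "(\<Sum>j<n. ?c (A $$ (i,j)) * v $ j) = z * v $ i" if "i < n" for i
    using arg_cong[OF v(3), of "\<lambda>w. w $ i"] that A v(1)
    by (simp add: mult_mat_vec_def scalar_prod_def lessThan_atLeast0 row_def)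
  have sym': "A $$ (j,i) = A $$ (i,j)" if "i < n" "j < n" for i j
    using arg_cong[OF sym, of "\<lambda>B. B $$ (i,j)"] that A by simp
  define s where "s = (\<Sum>i<n. cmod (v $ i) ^ 2)"
  let ?S = "\<Sum>i<n. \<Sum>j<n. cnj (v $ i) * (?c (A $$ (i,j)) * v $ j)"
  have S: "?S = z * ?c s"
  proof -
    have "?S = (\<Sum>i<n. cnj (v $ i) * (z * v $ i))"
      by (simp add: Av sum_distrib_left[symmetric])
    also have "\<dots> = z * ?c s"
      unfolding s_def of_real_sum sum_distrib_left
      by (intro sum.cong refl) (simp add: complex_norm_square[unfolded power2_eq_square] power2_eq_square mult_ac flip: of_real_mult)
    finally show ?thesis .
  qed
  \<comment> \<open>\<open>?S\<close> is v^* A v, which is its own conjugate because A is real and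
    symmetric; by \<open>S\<close> it is also z times |v|^2, so z is real.\<close>
  have "cnj ?S = (\<Sum>j<n. \<Sum>i<n. v $ i * (?c (A $$ (i,j)) * cnj (v $ j)))"
    by (subst sum.swap) simp
  also have "\<dots> = ?S"
    by (intro sum.cong refl) (simp add: sym')
  finally have "cnj z * ?c s = z * ?c s" unfolding S by simp
  moreover have "s > 0"
  proof -
    obtain i where "i < n" "v $ i \<noteq> 0" using v(1,2) by (metis eq_vecI carrier_vecD index_zero_vec)
    then show ?thesis unfolding s_def by (intro sum_pos2[of _ i]) auto
  qed
  ultimately have "cnj z = z" by simp
  then obtain e where e: "z = ?c e" by (metis Reals_cnj_iff Reals_cases)
  moreover have "char_poly ?A = map_poly ?c (char_poly A)" by (rule of_real_hom.char_poly_hom[OF A])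
  ultimately have "?c (poly (char_poly A) e) = 0"
    using \<open>poly (char_poly ?A) z = 0\<close> poly_of_real by metis
  then have "poly (char_poly A) e = 0" by simp
  then show ?thesis using eigenvalue_root_char_poly[OF A] by auto
qed

lemma symmetric_unit_eigenvector:
  fixes A :: "real mat"
  assumes A: "A \<in> carrier_mat n n" and sym: "transpose_mat A = A" and "n > 0"
  shows "\<exists>e v. v \<in> carrier_vec n \<and> v \<bullet> v = 1 \<and> A *\<^sub>v v = e \<cdot>\<^sub>v v"
proof -
  obtain e v where v: "v \<in> carrier_vec n" "v \<noteq> 0\<^sub>v n" "A *\<^sub>v v = e \<cdot>\<^sub>v v"
    using symmetric_real_eigenvalue[OF assms] A unfolding eigenvalue_def eigenvector_def by auto
  have "v \<bullet> v > 0"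
  proof -
    obtain i where "i < n" "v $ i \<noteq> 0" using v(1,2) by (metis eq_vecI carrier_vecD index_zero_vec)
    then have "(\<Sum>i = 0..<n. v $ i * v $ i) > 0" by (intro sum_pos2[of _ i]) (auto simp: zero_less_mult_iff linorder_neq_iff)
    then show ?thesis using v(1) by (simp add: scalar_prod_def)
  qed
  define w where "w = (1 / sqrt (v \<bullet> v)) \<cdot>\<^sub>v v"
  have "w \<bullet> w = 1" using v(1) \<open>v \<bullet> v > 0\<close> by (simp add: w_def)
  moreover have "A *\<^sub>v w = e \<cdot>\<^sub>v w"
    using A v by (simp add: w_def mult_mat_vec smult_smult_assoc mult.commute)
  ultimately show ?thesis using v(1) by (intro exI[of _ e] exI[of _ w]) (auto simp: w_def)
qed

text \<open>H is the reflection 1 - 2 w w^T / |w|^2 with w = v - e_0, which swaps the two unit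
  vectors v and e_0. For v = e_0 the vector w vanishes and the identity serves instead.\<close>

lemma householder:
  fixes v :: "real vec"
  assumes v: "v \<in> carrier_vec n" "v \<bullet> v = 1" and "n > 0"
  shows "\<exists>H \<in> carrier_mat n n. H * H = 1\<^sub>m n \<and> transpose_mat H = H \<and> H *\<^sub>v unit_vec n 0 = v"
proof (cases "v = unit_vec n 0")
  case True
  then show ?thesis using assms by (intro bexI[of _ "1\<^sub>m n"]) auto
next
  case False
  define w where "w = v - unit_vec n 0"
  have w: "w \<in> carrier_vec n" using v by (simp add: w_def)
  have v1: "(\<Sum>i<n. v $ i * v $ i) = 1"
    using v by (simp add: scalar_prod_def lessThan_atLeast0)
  \<comment> \<open>This is |w|^2 = |v|^2 - 2 v_0 + 1 for the unit vector v.\<close>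
  define d where "d = 2 - 2 * v $ 0"
  have wi: "w $ i = v $ i - (if i = 0 then 1 else 0)" if "i < n" for i
    using that v by (simp add: w_def)
  have ww: "(\<Sum>i<n. w $ i * w $ i) = d"
  proof -
    have "(\<Sum>i<n. w $ i * w $ i) = (\<Sum>i<n. v $ i * v $ i - (if i = 0 then 2 * v $ i - 1 else 0))"
      by (intro sum.cong) (auto simp: wi algebra_simps)
    then show ?thesis using v1 \<open>n > 0\<close> by (simp add: sum_subtractf d_def)
  qed
  have "d \<noteq> 0"
  proof
    assume "d = 0"
    then have "\<forall>i\<in>{..<n}. w $ i * w $ i = 0" using ww by (subst sum_nonneg_eq_0_iff[symmetric]) auto
    then have "v = unit_vec n 0" using v by (intro eq_vecI) (auto simp: wi)
    then show False using False by simp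
  qed
  define H where "H = mat n n (\<lambda>(i,j). (if i = j then 1 else 0) - 2 / d * w $ i * w $ j)"
  have H: "H \<in> carrier_mat n n" by (simp add: H_def)
  have "H * H = 1\<^sub>m n"
  proof (rule eq_matI)
    fix i j assume ij: "i < dim_row (1\<^sub>m n :: real mat)" "j < dim_col (1\<^sub>m n :: real mat)"
    define c where "c = (2 / d * w $ i) * (2 / d * w $ j)"
    have "(H * H) $$ (i,j) = (\<Sum>k<n. ((if i = k then 1 else 0) - 2 / d * w $ i * w $ k) * ((if k = j then 1 else 0) - 2 / d * w $ k * w $ j))"
      using ij by (simp add: H_def scalar_prod_def lessThan_atLeast0)
    also have "\<dots> = (\<Sum>k<n. (if i = k then (if k = j then 1 else 0) - 2 / d * w $ k * w $ j else 0)
      - (if k = j then 2 / d * w $ i * w $ k else 0) + c * (w $ k * w $ k))"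
      by (intro sum.cong) (auto simp: algebra_simps c_def)
    also have "\<dots> = (if i = j then 1 else 0) - 2 / d * w $ i * w $ j - 2 / d * w $ i * w $ j + c * d"
      using ij ww by (simp add: sum.distrib sum_subtractf flip: sum_distrib_left)
    also have "\<dots> = (if i = j then 1 else 0)" using \<open>d \<noteq> 0\<close> by (simp add: c_def field_simps)
    finally show "(H * H) $$ (i,j) = 1\<^sub>m n $$ (i,j)" using ij by simp
  qed (auto simp: H_def)
  moreover have "transpose_mat H = H" by (rule eq_matI) (auto simp: H_def)
  moreover have "H *\<^sub>v unit_vec n 0 = v"
  proof (rule eq_vecI)
    fix i assume i: "i < dim_vec v"
    then have "(H *\<^sub>v unit_vec n 0) $ i = H $$ (i, 0)" using H v \<open>n > 0\<close> by simp
    also have "\<dots> = (if i = 0 then 1 else 0) - 2 / d * w $ i * w $ 0"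
      using i v \<open>n > 0\<close> by (simp add: H_def)
    also have "w $ 0 = - d / 2" using \<open>n > 0\<close> by (simp add: wi d_def)
    finally show "(H *\<^sub>v unit_vec n 0) $ i = v $ i" using \<open>d \<noteq> 0\<close> i v by (simp add: wi)
  qed (use v H in auto)
  ultimately show ?thesis using H by blast
qed


text \<open>Deflation: conjugation by a reflection carries a unit eigenvector to e_0, so the first
  column of \<open>B\<close> is a multiple of e_0. By symmetry so is the first row, and the
  induction hypothesis applies to the remaining block \<open>C\<close>.\<close>

theorem symmetric_spectral:
  fixes A :: "real mat"
  assumes "A \<in> carrier_mat n n" and "transpose_mat A = A"
  shows "\<exists>Q es. Q \<in> carrier_mat n n \<and> transpose_mat Q * Q = 1\<^sub>m n \<and> A = Q * mat_diag n es * transpose_mat Q"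
  using assms
proof (induction n arbitrary: A)
  case 0
  then show ?case by (intro exI[of _ "1\<^sub>m 0"] exI) auto
next
  case (Suc n A)
  note A = Suc.prems(1) and sym = Suc.prems(2)
  obtain e v where v: "v \<in> carrier_vec (Suc n)" "v \<bullet> v = 1" "A *\<^sub>v v = e \<cdot>\<^sub>v v"
    using symmetric_unit_eigenvector[OF A sym] by auto
  obtain H where H: "H \<in> carrier_mat (Suc n) (Suc n)" "H * H = 1\<^sub>m (Suc n)" "transpose_mat H = H" "H *\<^sub>v unit_vec (Suc n) 0 = v"
    using householder[OF v(1,2)] by auto
  define B where "B = H * A * H"
  have B: "B \<in> carrier_mat (Suc n) (Suc n)" using A H by (simp add: B_def)
  have Bsym: "transpose_mat B = B"
  proof -
    have "transpose_mat B = transpose_mat H * transpose_mat (H * A)"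
      unfolding B_def by (rule transpose_mult) (use A H in auto)
    also have "transpose_mat (H * A) = transpose_mat A * transpose_mat H"
      by (rule transpose_mult) (use A H in auto)
    finally show ?thesis using A H(1,3) sym by (simp add: B_def assoc_mult_mat[of _ "Suc n" "Suc n"])
  qed
  have "H *\<^sub>v v = unit_vec (Suc n) 0"
  proof -
    have "H *\<^sub>v v = (H * H) *\<^sub>v unit_vec (Suc n) 0"
      using H by (subst assoc_mult_mat_vec) auto
    then show ?thesis using H by simp
  qed
  then have Be: "B *\<^sub>v unit_vec (Suc n) 0 = e \<cdot>\<^sub>v unit_vec (Suc n) 0"
  proof -
    have "B *\<^sub>v unit_vec (Suc n) 0 = H *\<^sub>v (A *\<^sub>v v)"
      using A H(1,4) unfolding B_def
      by (metis assoc_mult_mat_vec mult_carrier_mat unit_vec_carrier mult_mat_vec_carrier)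
    then show ?thesis using v H(1) \<open>H *\<^sub>v v = _\<close> by (simp add: mult_mat_vec)
  qed
  have B0: "B $$ (i, 0) = (if i = 0 then e else 0)" if "i < Suc n" for i
    using arg_cong[OF Be, of "\<lambda>w. w $ i"] that B by simp
  have B0': "B $$ (0, i) = (if i = 0 then e else 0)" if "i < Suc n" for i
    using arg_cong[OF Bsym, of "\<lambda>C. C $$ (i,0)"] B0[OF that] that B by simp
  define C where "C = mat n n (\<lambda>(i,j). B $$ (Suc i, Suc j))"
  have C: "C \<in> carrier_mat n n" by (simp add: C_def)
  have "transpose_mat C = C"
  proof (rule eq_matI)
    fix i j assume "i < dim_row C" "j < dim_col C"
    then show "transpose_mat C $$ (i,j) = C $$ (i,j)"
      using arg_cong[OF Bsym, of "\<lambda>D. D $$ (Suc i,Suc j)"] B by (simp add: C_def)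
  qed (auto simp: C_def)
  from Suc.IH[OF C this] obtain Q es where
    Q: "Q \<in> carrier_mat n n" "transpose_mat Q * Q = 1\<^sub>m n" "C = Q * mat_diag n es * transpose_mat Q" by blast
  define R where "R = four_block_mat (1\<^sub>m 1) (0\<^sub>m 1 n) (0\<^sub>m n 1) Q"
  let ?D = "mat_diag (Suc n) (case_nat e es)"
  have R: "R \<in> carrier_mat (Suc n) (Suc n)" using Q(1) by (auto simp: R_def)
  have RT: "transpose_mat R = four_block_mat (1\<^sub>m 1) (0\<^sub>m 1 n) (0\<^sub>m n 1) (transpose_mat Q)"
    unfolding R_def using Q(1) by (subst transpose_four_block_mat[of _ 1 1 _ n _ n]) auto
  have D: "?D = four_block_mat (e \<cdot>\<^sub>m 1\<^sub>m 1) (0\<^sub>m 1 n) (0\<^sub>m n 1) (mat_diag n es)"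
    by (rule eq_matI) (auto simp: mat_diag_def split: nat.splits)
  have RR: "transpose_mat R * R = 1\<^sub>m (Suc n)"
    unfolding RT unfolding R_def using Q(1,2)
    by (subst mult_four_block_mat[of _ 1 1 _ n _ n _ _ 1 _ n]) auto
  have B': "B = four_block_mat (e \<cdot>\<^sub>m 1\<^sub>m 1) (0\<^sub>m 1 n) (0\<^sub>m n 1) C"
    using B by (intro eq_matI) (auto simp: C_def B0 B0' elim!: less_SucE)
  have "R * ?D * transpose_mat R = B"
  proof -
    have QD: "Q * mat_diag n es \<in> carrier_mat n n" using Q(1) by simp
    have "R * ?D = four_block_mat (e \<cdot>\<^sub>m 1\<^sub>m 1) (0\<^sub>m 1 n) (0\<^sub>m n 1) (Q * mat_diag n es)"
      unfolding R_def D using Q(1)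
      by (subst mult_four_block_mat[of _ 1 1 _ n _ n _ _ 1 _ n]) (auto simp: left_mult_zero_mat[OF mat_diag_dim])
    also have "\<dots> * transpose_mat R = B"
      unfolding RT B' Q(3) using Q(1) QD
      by (subst mult_four_block_mat[of _ 1 1 _ n _ n _ _ 1 _ n])
        (auto simp: right_mult_zero_mat[OF QD] left_add_zero_mat[of _ n n])
    finally show ?thesis .
  qed
  moreover have "H * B * H = A"
  proof -
    have "H * B * H = (H * H) * A * (H * H)"
      using A H(1) by (simp add: B_def assoc_mult_mat[of _ "Suc n" "Suc n" _ "Suc n" _ "Suc n"])
    then show ?thesis using A H(2) by simp
  qed
  moreover have "(H * R) * ?D * transpose_mat (H * R) = H * (R * ?D * transpose_mat R) * H"
    using R H(1,3) mat_diag_dim[of "Suc n" "case_nat e es"]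
    by (simp add: transpose_mult[of _ "Suc n" "Suc n" _ "Suc n"] assoc_mult_mat[of _ "Suc n" "Suc n" _ "Suc n" _ "Suc n"] del: mat_diag_dim)
  ultimately have "(H * R) * ?D * transpose_mat (H * R) = A" by simp
  moreover have "transpose_mat (H * R) * (H * R) = 1\<^sub>m (Suc n)"
  proof -
    have "transpose_mat (H * R) * (H * R) = transpose_mat R * ((H * H) * R)"
      using R H(1,3) by (simp add: transpose_mult[of _ "Suc n" "Suc n"] assoc_mult_mat[of _ "Suc n" "Suc n" _ "Suc n" _ "Suc n"])
    then show ?thesis using R H(2) RR by simp
  qed
  ultimately show ?case using R H(1) by (intro exI[of _ "H * R"] exI[of _ "case_nat e es"]) auto
qed


lemma det_mat_diag: "det (mat_diag n f) = (\<Prod>k<n. f k)"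
  by (subst det_upper_triangular[OF _ mat_diag_dim])
    (auto simp: upper_triangular_def mat_diag_def diag_mat_def prod.list_conv_set_nth lessThan_atLeast0 intro!: prod.cong)

text \<open>The entrywise sums have the shape in which the Gram matrix is later expressed through
  its norms, so that two diagonal forms can be compared in the same variables. Orthonormality of the
  rows of \<open>q\<close> makes the passage from y to the values of the linear forms norm
  preserving.\<close>

lemma symmetric_diagonalization:
  fixes A :: "real mat"
  assumes A: "A \<in> carrier_mat n n" and sym: "transpose_mat A = A"
  obtains q e where
    "\<And>k l. k < n \<Longrightarrow> l < n \<Longrightarrow> (\<Sum>i<n. q k i * q l i) = (if k = l then 1 else 0 :: real)"
    "\<And>i j. i < n \<Longrightarrow> j < n \<Longrightarrow> A $$ (i,j) = (\<Sum>k<n. e k * q i k * q j k)"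
    "sig A = (\<Sum>k<n. if e k > 0 then 1 else if e k < 0 then -1 else 0)"
    "det A = (\<Prod>k<n. e k)"
proof -
  obtain Q e where Q: "Q \<in> carrier_mat n n" "transpose_mat Q * Q = 1\<^sub>m n" "A = Q * mat_diag n e * transpose_mat Q"
    using symmetric_spectral[OF assms] by blast
  have Q': "Q * transpose_mat Q = 1\<^sub>m n" using Q(1,2) by (intro mat_mult_left_right_inverse[of "transpose_mat Q"]) auto
  have D: "mat_diag n e \<in> carrier_mat n n" by simp
  have sim: "similar_mat A (mat_diag n e)"
    using Q A Q' by (intro similar_matI[of _ _ Q "transpose_mat Q" n]) auto
  have cp: "char_poly A = (\<Prod>a\<leftarrow>map e [0..<n]. [:- a, 1:])"
    unfolding char_poly_similar[OF sim]
    by (subst char_poly_upper_triangular[OF D]) (auto simp: upper_triangular_def mat_diag_def diag_mat_def intro!: arg_cong[where f = prod_list])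
  have len: "length (filter P (map e [0..<n])) = card {k. k < n \<and> P (e k)}" for P
    unfolding length_filter_conv_card by (rule arg_cong[where f = card]) auto
  show thesis
  proof (rule that[of "\<lambda>i j. Q $$ (i,j)" e])
    show "(\<Sum>i<n. Q $$ (k,i) * Q $$ (l,i)) = (if k = l then 1 else 0)" if "k < n" "l < n" for k l
      using arg_cong[OF Q', of "\<lambda>M. M $$ (k,l)"] that Q(1) by (simp add: scalar_prod_def lessThan_atLeast0)
    show "A $$ (i,j) = (\<Sum>k<n. e k * Q $$ (i,k) * Q $$ (j,k))" if "i < n" "j < n" for i j
      unfolding Q(3) using that Q(1) by (simp add: mat_diag_mult_right scalar_prod_def lessThan_atLeast0 mult_ac)
    show "sig A = (\<Sum>k<n. if e k > 0 then 1 else if e k < 0 then -1 else 0)"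
    proof -
      have "(\<Sum>k<n. if e k > 0 then 1 else if e k < 0 then -1 else 0 :: int) =
        (\<Sum>k<n. (if e k > 0 then 1 else 0) - (if e k < 0 then 1 else 0))"
        by (rule sum.cong) auto
      also have "\<dots> = int (card {k. k < n \<and> e k > 0}) - int (card {k. k < n \<and> e k < 0})"
        by (simp add: sum_subtractf sum.If_cases Int_def)
      finally show ?thesis unfolding sig_char_poly_linear[OF A cp] len by simp
    qed
    show "det A = (\<Prod>k<n. e k)"
      unfolding det_similar[OF sim] by (rule det_mat_diag)
  qed
qed

section \<open>Sylvester's law of inertia for approximate congruence\<close>

lemma exists_common_zero:
  fixes r :: "'i \<Rightarrow> nat \<Rightarrow> real"
  assumes "finite I" "card I < n"
  shows "\<exists>y. (\<exists>i<n. y i \<noteq> 0) \<and> (\<forall>k\<in>I. (\<Sum>i<n. r k i * y i) = 0)"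
proof -
  obtain f where f: "bij_betw f {..<card I} I" using assms(1) ex_bij_betw_nat_finite[of I] by (auto simp: lessThan_atLeast0)
  \<comment> \<open>Zero rows pad the system to a square one; row \<open>card I\<close> is zero, so
    the determinant vanishes.\<close>
  define M where "M = mat n n (\<lambda>(k,i). if k < card I then r (f k) i else 0)"
  have M: "M \<in> carrier_mat n n" by (simp add: M_def)
  have "det M = 0"
    unfolding laplace_expansion_row[OF M assms(2)] using assms(2) by (intro sum.neutral) (auto simp: M_def)
  then obtain v where v: "v \<in> carrier_vec n" "v \<noteq> 0\<^sub>v n" "M *\<^sub>v v = 0\<^sub>v n"
    using det_0_iff_vec_prod_zero_field[OF M] by blast
  show ?thesis
  proof (intro exI[of _ "\<lambda>i. v $ i"] conjI ballI)
    show "\<exists>i<n. v $ i \<noteq> 0" using v(1,2) by (metis eq_vecI carrier_vecD index_zero_vec)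
    fix k assume "k \<in> I"
    then have "k \<in> f ` {..<card I}" using f by (simp add: bij_betw_def)
    then obtain j where j: "j < card I" "f j = k" by auto
    then show "(\<Sum>i<n. r k i * v $ i) = 0"
      using arg_cong[OF v(3), of "\<lambda>w. w $ j"] assms(2) v(1) by (simp add: M_def scalar_prod_def lessThan_atLeast0)
  qed
qed

lemma quadratic_form_diag:
  fixes q :: "nat \<Rightarrow> nat \<Rightarrow> real"
  shows "(\<Sum>i<n. \<Sum>j<n. (\<Sum>k<n. e k * q i k * q j k) * y i * y j) = (\<Sum>k<n. e k * (\<Sum>i<n. q i k * y i)\<^sup>2)"
proof -
  have "(\<Sum>k<n. e k * (\<Sum>i<n. q i k * y i)\<^sup>2) = (\<Sum>k<n. \<Sum>i<n. \<Sum>j<n. e k * q i k * q j k * y i * y j)"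
    by (simp add: power2_eq_square sum_product sum_distrib_left mult_ac)
  also have "\<dots> = (\<Sum>i<n. \<Sum>j<n. \<Sum>k<n. e k * q i k * q j k * y i * y j)"
    by (subst sum.swap) (intro sum.cong refl sum.swap)
  finally show ?thesis by (simp add: sum_distrib_right)
qed


text \<open>If \<open>e\<close> had more positive entries than \<open>d\<close>, the linear forms
  with \<open>e\<close> not positive and those with \<open>d\<close> positive would be fewer than n
  and would have a common zero y \<noteq> 0. There the first quadratic form is at least c |y|^2 and
  the second at most 0, while they differ by at most \<epsilon> n |y|^2. The matrix \<open>S\<close>
  may be arbitrarily large.\<close>

lemma inertia_le:
  fixes q S :: "nat \<Rightarrow> nat \<Rightarrow> real" and e d :: "nat \<Rightarrow> real"
  assumes q: "\<And>k l. k < n \<Longrightarrow> l < n \<Longrightarrow> (\<Sum>i<n. q k i * q l i) = (if k = l then 1 else 0)"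
    and \<epsilon>: "\<And>k. k < n \<Longrightarrow> e k > 0 \<Longrightarrow> e k \<ge> c" "\<epsilon> * real n < c"
    and close: "\<And>i j. i < n \<Longrightarrow> j < n \<Longrightarrow>
      \<bar>(\<Sum>k<n. e k * q i k * q j k) - (\<Sum>k<n. d k * S i k * S j k)\<bar> \<le> \<epsilon>"
  shows "card {k. k < n \<and> e k > 0} \<le> card {k. k < n \<and> d k > 0}"
proof (rule ccontr)
  let ?P = "{k. k < n \<and> e k > 0}" and ?N = "{k. k < n \<and> \<not> e k > 0}" and ?p = "{k. k < n \<and> d k > 0}"
  assume "\<not> ?thesis"
  moreover have "card ?N + card ?P = n"
  proof -
    have "card ?N + card ?P = card (?N \<union> ?P)" by (rule card_Un_disjoint[symmetric]) auto
    also have "?N \<union> ?P = {..<n}" by auto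
    finally show ?thesis by simp
  qed
  \<comment> \<open>A disjoint sum, since the same index may label one form from each
    family.\<close>
  ultimately have "card (?N <+> ?p) < n" by (simp add: card_Plus)
  from exists_common_zero[OF _ this, of "case_sum (\<lambda>k i. q i k) (\<lambda>k i. S i k)"]
  obtain y where y1: "\<exists>i<n. y i \<noteq> 0"
    and y0: "\<forall>k\<in>?N <+> ?p. (\<Sum>i<n. case_sum (\<lambda>k i. q i k) (\<lambda>k i. S i k) k i * y i) = 0"
    by auto
  have y2: "(\<Sum>i<n. q i k * y i) = 0" if "k \<in> ?N" for k
    using bspec[OF y0 InlI[OF that]] by simp
  have y3: "(\<Sum>i<n. S i k * y i) = 0" if "k \<in> ?p" for k
    using bspec[OF y0 InrI[OF that]] by simp
  define Y where "Y = (\<Sum>i<n. (y i)\<^sup>2)"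
  have "Y > 0" using y1 unfolding Y_def by (auto intro: sum_pos2)
  have norm: "(\<Sum>k<n. (\<Sum>i<n. q i k * y i)\<^sup>2) = Y"
  proof -
    have "(\<Sum>k<n. (\<Sum>i<n. q i k * y i)\<^sup>2) = (\<Sum>i<n. \<Sum>j<n. (\<Sum>k<n. 1 * q i k * q j k) * y i * y j)"
      unfolding quadratic_form_diag by simp
    also have "\<dots> = (\<Sum>i<n. \<Sum>j<n. if i = j then (y i)\<^sup>2 else 0)"
      by (intro sum.cong refl) (simp add: q power2_eq_square)
    finally show ?thesis by (simp add: Y_def)
  qed
  let ?A = "\<lambda>i j. \<Sum>k<n. e k * q i k * q j k" and ?B = "\<lambda>i j. \<Sum>k<n. d k * S i k * S j k"
  have "c * Y \<le> (\<Sum>i<n. \<Sum>j<n. ?A i j * y i * y j)"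
    unfolding quadratic_form_diag norm[symmetric] sum_distrib_left
  proof (rule sum_mono)
    fix k assume "k \<in> {..<n}"
    then show "c * (\<Sum>i<n. q i k * y i)\<^sup>2 \<le> e k * (\<Sum>i<n. q i k * y i)\<^sup>2"
      using \<epsilon>(1)[of k] y2[of k] by (cases "e k > 0") (auto intro: mult_right_mono)
  qed
  moreover have "(\<Sum>i<n. \<Sum>j<n. ?B i j * y i * y j) \<le> 0"
    unfolding quadratic_form_diag
  proof (rule sum_nonpos)
    fix k assume "k \<in> {..<n}"
    then show "d k * (\<Sum>i<n. S i k * y i)\<^sup>2 \<le> 0"
      using y3[of k] by (cases "d k > 0") (auto intro: mult_nonpos_nonneg)
  qed
  moreover have "(\<Sum>i<n. \<Sum>j<n. ?A i j * y i * y j) - (\<Sum>i<n. \<Sum>j<n. ?B i j * y i * y j) \<le> \<epsilon> * (real n * Y)"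
  proof -
    have "(\<Sum>i<n. \<Sum>j<n. ?A i j * y i * y j) - (\<Sum>i<n. \<Sum>j<n. ?B i j * y i * y j) =
      (\<Sum>i<n. \<Sum>j<n. (?A i j - ?B i j) * (y i * y j))"
      by (simp add: sum_subtractf left_diff_distrib mult.assoc)
    also have "\<dots> \<le> (\<Sum>i<n. \<Sum>j<n. \<epsilon> * (((y i)\<^sup>2 + (y j)\<^sup>2) / 2))"
    proof (intro sum_mono)
      fix i j assume "i \<in> {..<n}" "j \<in> {..<n}"
      then have "\<bar>?A i j - ?B i j\<bar> \<le> \<epsilon>" using close by simp
      \<comment> \<open>Summed over all i and j, these bounds give n |y|^2, which is the origin of
        the factor n in the hypothesis on \<epsilon>.\<close>
      moreover have "\<bar>y i * y j\<bar> \<le> ((y i)\<^sup>2 + (y j)\<^sup>2) / 2"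
        using sum_squares_bound[of "\<bar>y i\<bar>" "\<bar>y j\<bar>"] by (simp add: abs_mult)
      ultimately have "\<bar>?A i j - ?B i j\<bar> * \<bar>y i * y j\<bar> \<le> \<epsilon> * (((y i)\<^sup>2 + (y j)\<^sup>2) / 2)"
        by (intro mult_mono) auto
      then show "(?A i j - ?B i j) * (y i * y j) \<le> \<epsilon> * (((y i)\<^sup>2 + (y j)\<^sup>2) / 2)"
        using abs_le_D1 abs_mult by metis
    qed
    also have "\<dots> = \<epsilon> * (real n * Y)"
      by (simp add: sum_distrib_left[symmetric] sum.distrib sum_divide_distrib[symmetric] Y_def)
    finally show ?thesis .
  qed
  ultimately have "c * Y \<le> \<epsilon> * real n * Y" by (simp add: mult.assoc)
  then show False using \<open>Y > 0\<close> \<epsilon>(2) by simp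
qed

text \<open>The nonzero determinant keeps the eigenvalues of A at a distance c from 0. Once
  \<epsilon> is small against c, \<open>inertia_le\<close> bounds the number of positive and of
  negative eigenvalues by the numbers for \<open>d\<close>. Both pairs of numbers add up to n, so
  the bounds are equalities. \<open>S\<close> and \<open>d\<close> may depend on \<epsilon>; only
  the signs of \<open>d\<close> are fixed.\<close>

theorem sig_eq_approx_congruent:
  fixes A :: "real mat" and s :: "nat \<Rightarrow> int"
  assumes A: "A \<in> carrier_mat n n" and sym: "transpose_mat A = A" and det: "det A \<noteq> 0"
    and s: "\<And>k. k < n \<Longrightarrow> \<bar>s k\<bar> = 1"
    and approx: "\<And>\<epsilon>. \<epsilon> > 0 \<Longrightarrow> \<exists>S d. (\<forall>k<n. sgn (d k) = real_of_int (s k)) \<and>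
      (\<forall>i<n. \<forall>j<n. \<bar>A $$ (i,j) - (\<Sum>k<n. d k * S i k * S j k)\<bar> \<le> \<epsilon>)"
  shows "sig A = (\<Sum>k<n. s k)"
proof -
  obtain q e where
    q: "\<And>k l. k < n \<Longrightarrow> l < n \<Longrightarrow> (\<Sum>i<n. q k i * q l i) = (if k = l then 1 else 0 :: real)"
    and Ae: "\<And>i j. i < n \<Longrightarrow> j < n \<Longrightarrow> A $$ (i,j) = (\<Sum>k<n. e k * q i k * q j k)"
    and sig: "sig A = (\<Sum>k<n. if e k > 0 then 1 else if e k < 0 then -1 else 0)"
    and dete: "det A = (\<Prod>k<n. e k)"
  proof (rule symmetric_diagonalization[OF A sym], goal_cases)
    case (1 q e)
    show ?case by (rule that[of q e]) (use 1 in auto)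
  qed
  have nz: "e k \<noteq> 0" if "k < n" for k using det that unfolding dete by auto
  \<comment> \<open>The extra element 1 keeps the set nonempty when n = 0.\<close>
  define c where "c = Min (insert 1 ((\<lambda>k. \<bar>e k\<bar>) ` {..<n}))"
  have "c > 0" unfolding c_def using nz by (subst Min_gr_iff) auto
  have c: "c \<le> \<bar>e k\<bar>" if "k < n" for k unfolding c_def using that by (intro Min_le) auto
  define \<epsilon> where "\<epsilon> = c / (real n + 1)"
  have \<epsilon>: "\<epsilon> > 0" "\<epsilon> * real n < c" using \<open>c > 0\<close> by (auto simp: \<epsilon>_def field_simps)
  obtain S d where Sd: "\<forall>k<n. sgn (d k) = real_of_int (s k)"
    "\<forall>i<n. \<forall>j<n. \<bar>A $$ (i,j) - (\<Sum>k<n. d k * S i k * S j k)\<bar> \<le> \<epsilon>"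
    using approx[OF \<epsilon>(1)] by blast
  have d: "\<And>k. k < n \<Longrightarrow> sgn (d k) = real_of_int (s k)" using Sd(1) by blast
  have close: "\<And>i j. i < n \<Longrightarrow> j < n \<Longrightarrow> \<bar>(\<Sum>k<n. e k * q i k * q j k) - (\<Sum>k<n. d k * S i k * S j k)\<bar> \<le> \<epsilon>"
    using Sd(2) by (simp add: Ae)
  have "card {k. k < n \<and> e k > 0} \<le> card {k. k < n \<and> d k > 0}"
  proof (rule inertia_le[where q = q and S = S and c = c and \<epsilon> = \<epsilon>])
    show "c \<le> e k" if "k < n" "e k > 0" for k using c[OF that(1)] that(2) by simp
  qed (fact q \<epsilon>(2) close)+
  \<comment> \<open>The same bound for the negated forms, which counts negative entries.\<close>
  moreover have "card {k. k < n \<and> - e k > 0} \<le> card {k. k < n \<and> - d k > 0}"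
  proof (rule inertia_le[where q = q and S = S and c = c and \<epsilon> = \<epsilon>])
    show "c \<le> - e k" if "k < n" "- e k > 0" for k using c[OF that(1)] that(2) by simp
    show "\<bar>(\<Sum>k<n. - e k * q i k * q j k) - (\<Sum>k<n. - d k * S i k * S j k)\<bar> \<le> \<epsilon>" if "i < n" "j < n" for i j
      using close[OF that] by (simp add: sum_negf)
  qed (fact q \<epsilon>(2))+
  moreover have split: "card {k. k < n \<and> f k > 0} + card {k. k < n \<and> - f k > 0} = n" if "\<And>k. k < n \<Longrightarrow> f k \<noteq> 0" for f :: "nat \<Rightarrow> real"
  proof -
    have "card {k. k < n \<and> f k > 0} + card {k. k < n \<and> - f k > 0} = card ({k. k < n \<and> f k > 0} \<union> {k. k < n \<and> - f k > 0})"
      by (rule card_Un_disjoint[symmetric]) auto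
    also have "{k. k < n \<and> f k > 0} \<union> {k. k < n \<and> - f k > 0} = {..<n}"
      using that by (auto simp: less_le)
    finally show ?thesis by simp
  qed
  moreover have dnz: "d k \<noteq> 0" if "k < n" for k using d[OF that] s[OF that] by auto
  ultimately have "card {k. k < n \<and> e k > 0} = card {k. k < n \<and> d k > 0}"
    "card {k. k < n \<and> - e k > 0} = card {k. k < n \<and> - d k > 0}"
    using split[of e, OF nz] split[of d, OF dnz] by linarith+
  moreover have "(\<Sum>k<n. if f k > 0 then 1 else if f k < 0 then -1 else 0 :: int) =
    int (card {k. k < n \<and> f k > 0}) - int (card {k. k < n \<and> - f k > 0})" for f :: "nat \<Rightarrow> real"
  proof -
    have "(\<Sum>k<n. if f k > 0 then 1 else if f k < 0 then -1 else 0 :: int) =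
      (\<Sum>k<n. (if f k > 0 then 1 else 0) - (if - f k > 0 then 1 else 0))"
      by (rule sum.cong) auto
    also have "\<dots> = int (card {k. k < n \<and> f k > 0}) - int (card {k. k < n \<and> - f k > 0})"
      by (simp add: sum_subtractf sum.If_cases Int_def)
    finally show ?thesis .
  qed
  ultimately have "sig A = (\<Sum>k<n. if d k > 0 then 1 else if d k < 0 then -1 else 0 :: int)"
    unfolding sig by simp
  also have "\<dots> = (\<Sum>k<n. s k)"
  proof (rule sum.cong)
    fix k assume "k \<in> {..<n}"
    then show "(if d k > 0 then 1 else if d k < 0 then -1 else 0) = s k"
      using d[of k] by (auto simp: sgn_if split: if_splits)
  qed simp
  finally show ?thesis .
qed

section \<open>Generating functions of signs\<close>

abbreviation coeff2 :: "int fps fps \<Rightarrow> nat \<Rightarrow> nat \<Rightarrow> int" where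
  "coeff2 f m1 m2 \<equiv> fps_nth (fps_nth f m2) m1"


text \<open>The sign of (s - 1)(s - 2)...(s - n) when s is none of 1, ..., n and A is the floor of s
  truncated at 0: the first A factors are positive and all later ones negative.\<close>

definition flip_sign :: "nat \<Rightarrow> nat \<Rightarrow> int" where
  "flip_sign n A = (if n \<le> A then 1 else (-1) ^ (n - A))"

lemma flip_sign_simps [simp]:
  "flip_sign 0 A = 1" "flip_sign (Suc n) 0 = - flip_sign n 0"
  "flip_sign (Suc n) (Suc A) = flip_sign n A"
  by (auto simp: flip_sign_def)

lemma flip_sign_diff2:
  "flip_sign (Suc (Suc n)) A - flip_sign n A = (if Suc n = A then -2 else 0)"
proof (induction n arbitrary: A)
  case 0 then show ?case by (cases A; cases "A - 1") auto
next
  case (Suc n) then show ?case by (cases A) auto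
qed

lemma coeff2_shift:
  "coeff2 (X1 ^ i * (X2 ^ j * s)) m1 m2 = (if m1 < i \<or> m2 < j then 0 else coeff2 s (m1 - i) (m2 - j))"
proof -
  have 2: "fps_nth (X2 ^ j * s) m2 = (if m2 < j then 0 else fps_nth s (m2 - j))" for s m2
    by (simp add: X2_def fps_X_power_mult_nth)
  have 1: "coeff2 (X1 ^ i * s) m1 m2 = (if m1 < i then 0 else coeff2 s (m1 - i) m2)" for s m2 m1
    by (simp add: X1_def fps_const_power fps_X_power_mult_nth)
  show ?thesis by (simp add: 1 2)
qed

lemma coeff2_shifts:
  "coeff2 (X1 ^ i * s) m1 m2 = (if m1 < i then 0 else coeff2 s (m1 - i) m2)"
  "coeff2 (X2 ^ j * s) m1 m2 = (if m2 < j then 0 else coeff2 s m1 (m2 - j))"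
  "coeff2 ((X1 * X2) ^ i * s) m1 m2 = (if m1 < i \<or> m2 < i then 0 else coeff2 s (m1 - i) (m2 - i))"
  using coeff2_shift[of i 0 s m2 m1] coeff2_shift[of 0 j s m2 m1] coeff2_shift[of i i s m2 m1]
  by (simp_all add: power_mult_distrib mult.assoc)

lemmas coeff2_shifts1 = coeff2_shifts(1,3)[where i = 1, simplified] coeff2_shifts(2)[where j = 1, simplified]

lemma coeff2_monom:
  "coeff2 (X1 ^ i * X2 ^ j) m1 m2 = (if m1 = i \<and> m2 = j then 1 else 0)"
  using coeff2_shift[of i j 1 m2 m1] by auto

lemma coeff2_monoms:
  "coeff2 1 m1 m2 = (if m1 = 0 \<and> m2 = 0 then 1 else 0)"
  "coeff2 (X1 ^ i) m1 m2 = (if m1 = i \<and> m2 = 0 then 1 else 0)"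
  "coeff2 (X2 ^ i) m1 m2 = (if m1 = 0 \<and> m2 = i then 1 else 0)"
  "coeff2 ((X1 * X2) ^ i) m1 m2 = (if m1 = i \<and> m2 = i then 1 else 0)"
  using coeff2_monom[of i 0 m2 m1] coeff2_monom[of 0 i m2 m1] coeff2_monom[of i i m2 m1]
  by (simp_all add: power_mult_distrib)

lemmas coeff2_monoms1 = coeff2_monoms(2-)[where i = 1, simplified]

lemma coeff2_numeral: "coeff2 (numeral k * s) m1 m2 = numeral k * coeff2 s m1 m2"
  by (simp add: fps_numeral_fps_const)

lemmas coeff2_simps = coeff2_shifts coeff2_shifts1 coeff2_monoms coeff2_monoms1 coeff2_numeral

lemma fps2_eqI: "(\<And>m1 m2. coeff2 f m1 m2 = coeff2 g m1 m2) \<Longrightarrow> f = g"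
  by (auto simp: fps_eq_iff)

text \<open>\<open>gen2\<close> and \<open>gen3\<close> are signature characters of Verma modules of
  sl_2, in the variable x2 and in the variable x1 x2 respectively.\<close>

definition gen2 :: "nat \<Rightarrow> int fps fps" where
  "gen2 a = Abs_fps (\<lambda>m2. Abs_fps (\<lambda>m1. if m1 = 0 then flip_sign m2 a else 0))"

definition gen3 :: "nat \<Rightarrow> int fps fps" where
  "gen3 a = Abs_fps (\<lambda>m2. Abs_fps (\<lambda>m1. if m1 = m2 then flip_sign m2 a else 0))"

text \<open>The coefficientwise form of (1 - x^2) times the series of signs being 1 + x - 2 x^(A+1):
  signs two steps apart agree, except across the place where the flipping begins.\<close>

lemma flip_sign_second_diff:
  "flip_sign m A - (if m < 2 then 0 else flip_sign (m - 2) A) =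
    (if m = 0 then 1 else 0) + (if m = 1 then 1 else 0) - 2 * (if m = Suc A then 1 else 0)"
proof -
  consider "m = 0" | "m = 1" | n where "m = Suc (Suc n)" by (metis One_nat_def not0_implies_Suc)
  then show ?thesis
    using flip_sign_diff2[of _ A] by cases (auto, (cases A; auto)+)
qed

lemma gen2_eq: "(1 - X2 ^ 2) * gen2 a = 1 + X2 - 2 * X2 ^ (a + 1)"
proof (rule fps2_eqI)
  fix m1 m2
  show "coeff2 ((1 - X2 ^ 2) * gen2 a) m1 m2 = coeff2 (1 + X2 - 2 * X2 ^ (a + 1)) m1 m2"
    using flip_sign_second_diff[of m2 a]
    by (auto simp: gen2_def left_diff_distrib coeff2_simps simp del: power_Suc)
qed

lemma gen3_eq: "(1 - (X1 * X2) ^ 2) * gen3 a = 1 + X1 * X2 - 2 * (X1 * X2) ^ (a + 1)"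
proof (rule fps2_eqI)
  fix m1 m2
  show "coeff2 ((1 - (X1 * X2) ^ 2) * gen3 a) m1 m2 = coeff2 (1 + X1 * X2 - 2 * (X1 * X2) ^ (a + 1)) m1 m2"
    using flip_sign_second_diff[of m2 a]
    by (auto simp: gen3_def left_diff_distrib coeff2_simps simp del: power_Suc)
qed


text \<open>With \<open>n1\<close> the floor of \<open>(\<alpha>\<^sub>1, \<lambda> + \<rho>)\<close>, this is the sign of the norm of the
Gelfand--Tsetlin vector indexed by \<open>(m1 - b, b, c)\<close>.\<close>

definition gt_sign :: "int \<Rightarrow> nat \<Rightarrow> nat \<Rightarrow> nat \<Rightarrow> nat \<Rightarrow> nat \<Rightarrow> int" where
  "gt_sign n1 a2 a3 m1 b c = flip_sign (Suc m1) (nat (n1 + int c + 1)) *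
     (if int b \<le> n1 + int c then 1 else - 1) * flip_sign b (nat n1) * flip_sign b a3 * flip_sign c a2"

definition gt_sum :: "int \<Rightarrow> nat \<Rightarrow> nat \<Rightarrow> nat \<Rightarrow> nat \<Rightarrow> int" where
  "gt_sum n1 a2 a3 m1 m2 = (\<Sum>b\<le>min m1 m2. gt_sign n1 a2 a3 m1 b (m2 - b))"

definition gt_char :: "int \<Rightarrow> nat \<Rightarrow> nat \<Rightarrow> int fps fps" where
  "gt_char n1 a2 a3 = Abs_fps (\<lambda>m2. Abs_fps (\<lambda>m1. gt_sum n1 a2 a3 m1 m2))"

section \<open>Recursions for the sums of signs\<close>

lemma flip_sign_Suc:
  "flip_sign (Suc b) a = (if a = 0 then - 1 else 1) * flip_sign b (a - 1)"
  by (cases a) auto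

lemma flip_sign_Suc_nat:
  "flip_sign (Suc b) (nat k) = (if k \<le> 0 then - 1 else 1) * flip_sign b (nat (k - 1))"
  by (cases "k \<le> 0") (auto simp: flip_sign_Suc[of b "nat k"] nat_diff_distrib)

text \<open>Lowering b, m1, n1 and a3 together strips one step from each factor that involves them.
  Since \<open>n1 \<ge> 0\<close>, the step stripped from the first factor is never a flip; the two
  factors in b flip exactly when \<open>n1 = 0\<close> and \<open>a3 = 0\<close>.\<close>

lemma gt_sign_row:
  assumes "n1 \<ge> 0"
  shows "gt_sign n1 a2 a3 (Suc m1) (Suc b) c =
    (if n1 = 0 then -1 else 1) * (if a3 = 0 then -1 else 1) * gt_sign (n1 - 1) a2 (a3 - 1) m1 b c"
  using assms by (auto simp: gt_sign_def flip_sign_Suc[of b a3] flip_sign_Suc_nat[of b n1] flip_sign_Suc_nat[of "Suc m1"] algebra_simps)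

text \<open>Only n1 + c enters the first two factors, so lowering c while raising n1 preserves them;
  for \<open>n1 < 0\<close> both n1 and n1 + 1 truncate to 0 in the third.\<close>

lemma gt_sign_col:
  assumes "n1 < 0"
  shows "gt_sign n1 a2 a3 m1 b (Suc c) =
    (if a2 = 0 then -1 else 1) * gt_sign (n1 + 1) (a2 - 1) a3 m1 b c"
  using assms by (auto simp: gt_sign_def flip_sign_Suc[of c a2] algebra_simps)

definition gt_row :: "int \<Rightarrow> nat \<Rightarrow> int fps fps" where
  "gt_row n1 a2 = Abs_fps (\<lambda>m2. Abs_fps (\<lambda>m1. flip_sign m1 (nat n1 + m2) * flip_sign m2 a2))"

text \<open>The terms with c = 0, that is b = m2, for negative n1, where the factors depending on n1
  multiply to (-1)^(m1 - m2).\<close>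

definition gt_col :: "nat \<Rightarrow> int fps fps" where
  "gt_col a3 = Abs_fps (\<lambda>m2. Abs_fps (\<lambda>m1. if m1 < m2 then 0 else flip_sign (m1 - m2) 0 * flip_sign m2 a3))"

lemma gt_char_row:
  assumes "n1 \<ge> 0"
  shows "gt_char n1 a2 a3 = gt_row n1 a2 +
    (if n1 = 0 then -1 else 1) * (if a3 = 0 then -1 else 1) * (X1 * X2 * gt_char (n1 - 1) a2 (a3 - 1))"
proof (rule fps2_eqI)
  fix m1 m2
  have sg: "coeff2 ((if P then -1 else 1) * (if Q then -1 else 1) * s) m1 m2 =
    (if P then -1 else 1) * (if Q then -1 else 1) * coeff2 s m1 m2" for P Q and s :: "int fps fps"
    by auto
  have 0: "gt_sign n1 a2 a3 m1 0 m2 = flip_sign m1 (nat n1 + m2) * flip_sign m2 a2"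
    using assms by (simp add: gt_sign_def flip_sign_Suc_nat[of m1] nat_add_distrib)
  show "coeff2 (gt_char n1 a2 a3) m1 m2 = coeff2 (gt_row n1 a2 +
    (if n1 = 0 then -1 else 1) * (if a3 = 0 then -1 else 1) * (X1 * X2 * gt_char (n1 - 1) a2 (a3 - 1))) m1 m2"
  proof (cases "m1 = 0 \<or> m2 = 0")
    case True
    then show ?thesis using 0
      by (auto simp: gt_char_def gt_sum_def gt_row_def coeff2_simps sg)
  next
    case False
    then obtain k1 k2 where k: "m1 = Suc k1" "m2 = Suc k2" by (metis not0_implies_Suc)
    have "gt_sum n1 a2 a3 m1 m2 = gt_sign n1 a2 a3 m1 0 m2 +
      (\<Sum>b\<le>min k1 k2. gt_sign n1 a2 a3 m1 (Suc b) (k2 - b))"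
      unfolding gt_sum_def k by (simp add: sum.atMost_Suc_shift del: sum.atMost_Suc)
    also have "(\<Sum>b\<le>min k1 k2. gt_sign n1 a2 a3 m1 (Suc b) (k2 - b)) =
      (if n1 = 0 then -1 else 1) * (if a3 = 0 then -1 else 1) * gt_sum (n1 - 1) a2 (a3 - 1) k1 k2"
      unfolding gt_sum_def k gt_sign_row[OF assms] by (simp add: sum_distrib_left)
    finally show ?thesis using 0 by (simp add: sg coeff2_simps gt_char_def gt_row_def k)
  qed
qed

lemma gt_char_col:
  assumes "n1 < 0"
  shows "gt_char n1 a2 a3 = gt_col a3 + (if a2 = 0 then -1 else 1) * (X2 * gt_char (n1 + 1) (a2 - 1) a3)"
proof (rule fps2_eqI)
  fix m1 m2
  have sg: "coeff2 ((if P then -1 else 1) * s) m1 m2 =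
    (if P then -1 else 1) * coeff2 s m1 m2" for P and s :: "int fps fps"
    by auto
  have 0: "gt_sign n1 a2 a3 m1 m2 0 = flip_sign (m1 - m2) 0 * flip_sign m2 a3" if "m2 \<le> m1"
    using assms that by (simp add: gt_sign_def) (auto simp: flip_sign_def minus_one_power_iff)
  have S: "(\<Sum>b\<le>min m1 k. gt_sign n1 a2 a3 m1 b (Suc k - b)) = (if a2 = 0 then -1 else 1) * gt_sum (n1 + 1) (a2 - 1) a3 m1 k" for k
    unfolding gt_sum_def sum_distrib_left
    by (rule sum.cong) (auto simp: Suc_diff_le gt_sign_col[OF assms])
  show "coeff2 (gt_char n1 a2 a3) m1 m2 =
    coeff2 (gt_col a3 + (if a2 = 0 then -1 else 1) * (X2 * gt_char (n1 + 1) (a2 - 1) a3)) m1 m2"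
  proof (cases m2)
    case 0
    then show ?thesis using \<open>m2 \<le> m1 \<Longrightarrow> _\<close>
      by (simp add: gt_char_def gt_sum_def gt_col_def coeff2_simps sg del: fps_mult_nth_0)
  next
    case (Suc k)
    have "gt_sum n1 a2 a3 m1 m2 = (if m2 \<le> m1 then gt_sign n1 a2 a3 m1 m2 0 else 0) +
       (\<Sum>b\<le>min m1 k. gt_sign n1 a2 a3 m1 b (Suc k - b))"
      unfolding gt_sum_def Suc by (cases "Suc k \<le> m1") (auto simp: min_def intro: arg_cong[where f = "sum _"])
    then show ?thesis using \<open>m2 \<le> m1 \<Longrightarrow> _\<close>
      by (auto simp: sg coeff2_simps gt_char_def gt_col_def S Suc)
  qed
qed

text \<open>In the row of x2^m2 the flipping starts at x1-degree n1 + m2 + 1. This place moves along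
  the diagonal as m2 grows, so the correction term is a series in x1 x2 shifted by
  x1^(n1+1).\<close>

lemma gt_row_eq: "n1 \<ge> 0 \<Longrightarrow> (1 - X1 ^ 2) * gt_row n1 a2 = (1 + X1) * gen2 a2 - 2 * (X1 ^ (nat n1 + 1) * gen3 a2)"
proof (rule fps2_eqI)
  fix m1 m2
  show "coeff2 ((1 - X1 ^ 2) * gt_row n1 a2) m1 m2 =
    coeff2 ((1 + X1) * gen2 a2 - 2 * (X1 ^ (nat n1 + 1) * gen3 a2)) m1 m2"
    using arg_cong[OF flip_sign_second_diff[of m1 "nat n1 + m2"], of "\<lambda>z. z * flip_sign m2 a2"]
    by (auto simp: gen2_def gen3_def gt_row_def left_diff_distrib distrib_right coeff2_simps simp del: power_Suc split: if_splits)
qed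

text \<open>Each row is a geometric series in -x1 that starts on the diagonal.\<close>

lemma gt_col_eq: "(1 + X1) * gt_col a3 = gen3 a3"
proof (rule fps2_eqI)
  fix m1 m2
  have "flip_sign (m1 - m2) 0 + flip_sign (m1 - 1 - m2) 0 = 0" if "m1 > m2"
    using flip_sign_Suc[of "m1 - m2 - 1" 0] that by (simp add: Suc_diff_Suc)
  then show "coeff2 ((1 + X1) * gt_col a3) m1 m2 = coeff2 (gen3 a3) m1 m2"
    by (auto simp: gen3_def gt_col_def distrib_right coeff2_simps distrib_right[symmetric] simp del: power_Suc)
qed


section \<open>Clearing the denominator, and the induction on the floors\<close>

lemma gt_row_denom:
  assumes "n1 \<ge> 0"
  shows "gt_row n1 a2 * A2_denom = (1 + X1) * (1 - (X1 * X2)\<^sup>2) * (1 + X2 - 2 * X2 ^ (a2 + 1))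
    - 2 * X1 ^ (nat n1 + 1) * (1 - X2\<^sup>2) * (1 + X1 * X2 - 2 * (X1 * X2) ^ (a2 + 1))"
proof -
  have "gt_row n1 a2 * A2_denom = (1 - X2\<^sup>2) * (1 - (X1 * X2)\<^sup>2) * ((1 - X1\<^sup>2) * gt_row n1 a2)"
    by (simp add: A2_denom_def power_mult_distrib mult_ac)
  also have "\<dots> = (1 + X1) * (1 - (X1 * X2)\<^sup>2) * ((1 - X2\<^sup>2) * gen2 a2)
    - 2 * X1 ^ (nat n1 + 1) * (1 - X2\<^sup>2) * ((1 - (X1 * X2)\<^sup>2) * gen3 a2)"
    unfolding gt_row_eq[OF assms] by (simp only: algebra_simps)
  finally show ?thesis unfolding gen2_eq gen3_eq .
qed

lemma gt_col_denom:
  "gt_col a3 * A2_denom = (1 - X1) * (1 - X2\<^sup>2) * (1 + X1 * X2 - 2 * (X1 * X2) ^ (a3 + 1))"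
proof -
  have "gt_col a3 * A2_denom = (1 - X1) * (1 - X2\<^sup>2) * ((1 - (X1 * X2)\<^sup>2) * ((1 + X1) * gt_col a3))"
    by (simp add: A2_denom_def power_mult_distrib power2_eq_square algebra_simps)
  then show ?thesis unfolding gen3_eq gt_col_eq .
qed

lemma gt_char_row_denom:
  assumes "n1 \<ge> 0"
  shows "gt_char n1 a2 a3 * A2_denom = gt_row n1 a2 * A2_denom +
    (if n1 = 0 then -1 else 1) * (if a3 = 0 then -1 else 1) * (X1 * X2 * (gt_char (n1 - 1) a2 (a3 - 1) * A2_denom))"
  unfolding gt_char_row[OF assms, of a2 a3] by (simp add: algebra_simps)

lemma gt_char_col_denom:
  assumes "n1 < 0"
  shows "gt_char n1 a2 a3 * A2_denom = gt_col a3 * A2_denom +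
    (if a2 = 0 then -1 else 1) * (X2 * (gt_char (n1 + 1) (a2 - 1) a3 * A2_denom))"
  unfolding gt_char_col[OF assms, of a2 a3] by (simp add: algebra_simps)

text \<open>The arguments are untruncated integers: the relation between the three floors fails
  after truncation, and the induction has to pass through negative values.\<close>

definition gt_char_ok :: "int \<Rightarrow> int \<Rightarrow> int \<Rightarrow> bool" where
  "gt_char_ok n1 n2 n3 \<longleftrightarrow> gt_char n1 (nat n2) (nat n3) * A2_denom = ftilde (nat n1) (nat n2) (nat n3)"

lemma gt_char_ok_row:
  assumes "n1 > 0" "n3 = n1 + n2 \<or> n3 = n1 + n2 + 1" "gt_char_ok (n1 - 1) n2 (n3 - 1)"
  shows "gt_char_ok n1 n2 n3"
proof -
  obtain k where n1: "n1 = int (Suc k)" using assms(1) by (metis gr0_implies_Suc zero_less_imp_eq_int)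
  have *: "nat n3 - 1 = nat (n3 - 1)" by simp
  have ok: "gt_char (n1 - 1) (nat n2) (nat (n3 - 1)) * A2_denom = ftilde k (nat n2) (nat (n3 - 1))"
    using assms(3) by (simp add: gt_char_ok_def n1)
  have eq: "gt_char n1 (nat n2) (nat n3) * A2_denom = gt_row n1 (nat n2) * A2_denom +
    (if n3 \<le> 0 then -1 else 1) * (X1 * X2 * ftilde k (nat n2) (nat (n3 - 1)))"
    unfolding gt_char_row_denom[OF less_imp_le[OF assms(1)]] * ok using assms(1) by simp
  \<comment> \<open>Each case determines the order of the truncated floors, or leaves few
    possibilities, so that every min and max in \<open>ftilde\<close> can be evaluated before and
    after the step.\<close>
  consider (a) p d where "n2 = int p" "n3 = int (Suc (k + p + d))" "d = 0 \<or> d = 1"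
    | (b) p q where "n2 = - int (Suc p)" "n3 = int (Suc q)" "q \<le> k"
    | (c) p where "n2 = - int (Suc p)" "n3 \<le> 0"
  proof -
    consider "n2 \<ge> 0" | "n2 < 0" "n3 > 0" | "n2 < 0" "n3 \<le> 0" by linarith
    then show ?thesis
    proof cases
      case 1
      then show ?thesis using a[of "nat n2" "nat (n3 - n1 - n2)"] assms(2) n1 by auto
    next
      case 2
      then show ?thesis using b[of "nat (- n2 - 1)" "nat (n3 - 1)"] assms(2) n1 by auto
    next
      case 3
      then show ?thesis using c[of "nat (- n2 - 1)"] by auto
    qed
  qed
  then show ?thesis
  proof cases
    case a
    then show ?thesis unfolding gt_char_ok_def eq gt_row_denom[OF less_imp_le[OF assms(1)]]
      by (auto simp: n1 nat_add_distrib ftilde_def min_def max_def)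
        (simp_all add: power_add power2_eq_square power_mult_distrib algebra_simps)
  next
    case b
    then show ?thesis unfolding gt_char_ok_def eq gt_row_denom[OF less_imp_le[OF assms(1)]]
      by (auto simp: n1 nat_add_distrib ftilde_def min_def max_def)
        (simp_all add: power_add power2_eq_square power_mult_distrib algebra_simps)
  next
    case c
    then show ?thesis unfolding gt_char_ok_def eq gt_row_denom[OF less_imp_le[OF assms(1)]]
      by (auto simp: n1 nat_add_distrib ftilde_def min_def max_def)
        (simp_all add: power_add power2_eq_square power_mult_distrib algebra_simps)
  qed
qed

lemmas ftilde_expand = power_mult_distrib power_add power_Suc power_0 power_one_right power2_eq_square
  Suc_eq_plus1[symmetric] mult_1_left mult_1_right

text \<open>The column recursion for negative n1, with p + 1 and q the truncated second and third
  floors. The hypothesis lists the relative positions left open by the floor relation.\<close>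

lemma ftilde_col:
  assumes "q < p \<or> q = p \<or> q = Suc p"
  shows "(1 - X1) * (1 - X2\<^sup>2) * (1 + X1 * X2 - 2 * (X1 * X2) ^ (q + 1)) + X2 * ftilde 0 p q = ftilde 0 (Suc p) q"
proof -
  consider "q < p" | "q = p" | "q = Suc p" using assms by blast
  then show ?thesis
  proof cases
    case 1
    then have mm: "min q (Suc p) = q" "max p q = p" "max (Suc p) q = Suc p" "min q p = q" "min p q = q"
      "min (Suc p) q = q" by simp_all
    show ?thesis unfolding ftilde_def mm min_0L max_0L by (simp only: ftilde_expand) (simp add: algebra_simps)
  next
    case 2
    have mm: "min (Suc p) p = p" "max (Suc p) p = Suc p" "max p p = p" "min p p = p" by simp_all
    show ?thesis unfolding 2 ftilde_def mm min_0L max_0L by (simp only: ftilde_expand) (simp add: algebra_simps)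
  next
    case 3
    have mm: "min p (Suc p) = p" "max p (Suc p) = Suc p" "max (Suc p) (Suc p) = Suc p" "min (Suc p) (Suc p) = Suc p" by simp_all
    show ?thesis unfolding 3 ftilde_def mm min_0L max_0L by (simp only: ftilde_expand) (simp add: algebra_simps)
  qed
qed

text \<open>The row recursion from n1 = 0 to n1 = -1: the first argument is truncated to 0 on both
  sides, and the minus sign is the flip at \<open>n1 = 0\<close>.\<close>

lemma ftilde_row0:
  assumes "p = q \<or> p = Suc q"
  shows "(1 + X1) * (1 - (X1 * X2)\<^sup>2) * (1 + X2 - 2 * X2 ^ (p + 1))
    - 2 * X1 ^ (nat 0 + 1) * (1 - X2\<^sup>2) * (1 + X1 * X2 - 2 * (X1 * X2) ^ (p + 1)) - X1 * X2 * ftilde 0 p q = ftilde 0 p (Suc q)"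
  using assms
proof
  assume 1: "p = q"
  have mm: "min q (Suc q) = q" "max q (Suc q) = Suc q" "max q q = q" "min q q = q" "nat 0 = 0" by simp_all
  show ?thesis unfolding 1 ftilde_def mm min_0L max_0L by (simp only: ftilde_expand) (simp add: algebra_simps)
next
  assume 2: "p = Suc q"
  have mm: "min (Suc q) q = q" "max (Suc q) q = Suc q" "max (Suc q) (Suc q) = Suc q" "min (Suc q) (Suc q) = Suc q" "nat 0 = 0" by simp_all
  show ?thesis unfolding 2 ftilde_def mm min_0L max_0L by (simp only: ftilde_expand) (simp add: algebra_simps)
qed

lemma gt_char_ok_row0:
  assumes "n2 \<ge> 0" "n3 = n2 \<or> n3 = n2 + 1" "n3 > 0" "gt_char_ok (- 1) n2 (n3 - 1)"
  shows "gt_char_ok 0 n2 n3"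
proof -
  have *: "nat n3 - 1 = nat (n3 - 1)" by simp
  have ok: "gt_char (0 - 1) (nat n2) (nat (n3 - 1)) * A2_denom = ftilde 0 (nat n2) (nat (n3 - 1))"
    using assms(4) by (simp add: gt_char_ok_def)
  have eq: "gt_char 0 (nat n2) (nat n3) * A2_denom = gt_row 0 (nat n2) * A2_denom
     - (X1 * X2 * ftilde 0 (nat n2) (nat (n3 - 1)))"
    unfolding gt_char_row_denom[OF order.refl] * ok using assms(3) by simp
  obtain q p where q: "nat n3 = Suc q" "nat (n3 - 1) = q" and p: "nat n2 = p" "p = q \<or> p = Suc q"
  proof (rule that[OF _ refl refl])
    show "nat n3 = Suc (nat (n3 - 1))" using assms(3) by simp
    show "nat n2 = nat (n3 - 1) \<or> nat n2 = Suc (nat (n3 - 1))" using assms(1-3) by auto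
  qed
  show ?thesis using ftilde_row0[OF p(2)] unfolding gt_char_ok_def eq unfolding gt_row_denom[OF order.refl] p(1) q by simp
qed

lemma gt_char_ok_col:
  assumes "n1 < 0" "n3 = n1 + n2 \<or> n3 = n1 + n2 + 1" "gt_char_ok (n1 + 1) (n2 - 1) n3"
  shows "gt_char_ok n1 n2 n3"
proof -
  have *: "nat n2 - 1 = nat (n2 - 1)" by simp
  have ok: "gt_char (n1 + 1) (nat (n2 - 1)) (nat n3) * A2_denom = ftilde 0 (nat (n2 - 1)) (nat n3)"
    using assms(1,3) by (simp add: gt_char_ok_def)
  have eq: "gt_char n1 (nat n2) (nat n3) * A2_denom = gt_col (nat n3) * A2_denom +
     (if n2 \<le> 0 then -1 else 1) * (X2 * ftilde 0 (nat (n2 - 1)) (nat n3))"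
    unfolding gt_char_col_denom[OF assms(1)] * ok by simp
  have n1: "nat n1 = 0" using assms(1) by simp
  show ?thesis
  proof (cases "n2 \<le> 0")
    case True
    then show ?thesis using assms(1,2) unfolding gt_char_ok_def eq gt_col_denom n1
      by (auto simp: ftilde_def)
        (simp_all add: power_add power2_eq_square power_mult_distrib algebra_simps)
  next
    case False
    obtain p q where p: "nat n2 = Suc p" "nat (n2 - 1) = p" and q: "nat n3 = q" "q < p \<or> q = p \<or> q = Suc p"
    proof (rule that[OF _ refl refl])
      show "nat n2 = Suc (nat (n2 - 1))" using False by simp
      show "nat n3 < nat (n2 - 1) \<or> nat n3 = nat (n2 - 1) \<or> nat n3 = Suc (nat (n2 - 1))"
        using False assms(1,2) by arith
    qed
    show ?thesis using False ftilde_col[OF q(2)] unfolding gt_char_ok_def eq unfolding gt_col_denom n1 p q(1) by simp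
  qed
qed

text \<open>A row step from 0 to -1 followed by a column step back to 0 returns to the same series
  when the other arguments truncate to 0. The result is a fixed point equation with coefficient 1 +
  x1 x2^2, which \<open>ftilde 0 0 0\<close> satisfies as well.\<close>

lemma gt_char_ok_nonpos:
  assumes "n2 \<le> 0" "n3 \<le> 0"
  shows "gt_char_ok 0 n2 n3"
proof -
  let ?s = "gt_char 0 0 0 * A2_denom" and ?y = "X1 * X2"
  have "?s = gt_row 0 0 * A2_denom + ?y * (gt_char (- 1) 0 0 * A2_denom)"
    using gt_char_row_denom[of 0 0 0] by simp
  also have "gt_char (- 1) 0 0 * A2_denom = gt_col 0 * A2_denom - X2 * ?s"
    using gt_char_col_denom[of "-1" 0 0] by simp
  finally have "(1 + ?y * X2) * ?s = gt_row 0 0 * A2_denom + ?y * (gt_col 0 * A2_denom)"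
    by (simp add: algebra_simps)
  also have "\<dots> = (1 + ?y * X2) * ftilde 0 0 0"
    unfolding gt_row_denom[OF order.refl] gt_col_denom
    by (simp add: ftilde_def power2_eq_square algebra_simps)
  moreover have "1 + ?y * X2 \<noteq> 0"
  proof
    assume "1 + ?y * X2 = 0"
    then have "coeff2 (1 + ?y * X2) 0 0 = 0" by simp
    then show False by (simp add: X1_def X2_def)
  qed
  ultimately have "?s = ftilde 0 0 0" by simp
  then show ?thesis using assms by (simp add: gt_char_ok_def)
qed

text \<open>One loop, row step to n1 = -1 and column step back to 0, lowers n2 and n3 by one each.
  Induction on n2 thus ends in the case where both are at most 0.\<close>

lemma gt_char_ok_zero:
  assumes "n3 = n2 \<or> n3 = n2 + 1"
  shows "gt_char_ok 0 n2 n3"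
proof (cases "n2 < 0")
  case True
  then show ?thesis using assms by (intro gt_char_ok_nonpos) auto
next
  case False
  then obtain p where "n2 = int p" by (metis nonneg_int_cases not_less)
  then show ?thesis using assms
  proof (induction p arbitrary: n2 n3)
    case 0
    have "gt_char_ok (- 1) 0 0" by (rule gt_char_ok_col) (auto intro: gt_char_ok_nonpos)
    then show ?case using 0 gt_char_ok_row0[of 0 1] gt_char_ok_nonpos[of 0 0] by auto
  next
    case (Suc p)
    have "gt_char_ok 0 (n2 - 1) (n3 - 1)" using Suc by auto
    have "gt_char_ok (- 1) n2 (n3 - 1)" by (rule gt_char_ok_col) (use Suc.prems \<open>gt_char_ok 0 _ _\<close> in auto)
    then show ?case by (intro gt_char_ok_row0) (use Suc.prems in auto)
  qed
qed

lemma gt_char_ok_all: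
  assumes "n3 = n1 + n2 \<or> n3 = n1 + n2 + 1"
  shows "gt_char_ok n1 n2 n3"
proof -
  have "gt_char_ok (int k) n2 n3" if "n3 = int k + n2 \<or> n3 = int k + n2 + 1" for k n2 n3
    using that
  proof (induction k arbitrary: n2 n3)
    case 0
    then show ?case using gt_char_ok_zero by simp
  next
    case (Suc k)
    show ?case by (rule gt_char_ok_row) (use Suc in auto)
  qed
  moreover have "gt_char_ok (- int k) n2 n3" if "n3 = - int k + n2 \<or> n3 = - int k + n2 + 1" for k n2 n3
    using that
  proof (induction k arbitrary: n2 n3)
    case 0
    then show ?case using gt_char_ok_zero by simp
  next
    case (Suc k)
    show ?case by (rule gt_char_ok_col) (use Suc in auto)
  qed
  ultimately show ?thesis using assms by (cases n1 rule: int_cases2) auto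
qed

theorem gt_char_eq:
  fixes t1 t2 :: real
  shows "gt_char \<lfloor>t1\<rfloor> (nat \<lfloor>t2\<rfloor>) (nat \<lfloor>t1 + t2\<rfloor>) * A2_denom = ftilde (nat \<lfloor>t1\<rfloor>) (nat \<lfloor>t2\<rfloor>) (nat \<lfloor>t1 + t2\<rfloor>)"
proof -
  have "\<lfloor>t1 + t2\<rfloor> = \<lfloor>t1\<rfloor> + \<lfloor>t2\<rfloor> \<or> \<lfloor>t1 + t2\<rfloor> = \<lfloor>t1\<rfloor> + \<lfloor>t2\<rfloor> + 1" by linarith
  from gt_char_ok_all[OF this] show ?thesis by (simp add: gt_char_ok_def)
qed

section \<open>The Gelfand--Tsetlin model\<close>

text \<open>The product (s - 1)...(s - n). For s = (\<alpha>, \<lambda> + \<rho>) it is, up to the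
  factor n!, the norm of the n-th lowered vector of an sl_2 Verma module.\<close>

definition falling :: "real \<Rightarrow> nat \<Rightarrow> real" where
  "falling s n = (\<Prod>i<n. s - real (Suc i))"

lemma falling_0 [simp]: "falling s 0 = 1"
  by (simp add: falling_def)

lemma falling_Suc: "falling s (Suc n) = falling s n * (s - real n - 1)"
  by (simp add: falling_def)

lemma falling_add: "falling s (m + n) = falling s m * falling (s - real m) n"
  by (induction n) (simp_all add: falling_Suc algebra_simps)

lemma falling_shift: "(s - real n) * falling (s + 1) n = s * falling s n"
  using falling_add[of "s + 1" n 1] falling_add[of "s + 1" 1 n] by (simp add: falling_Suc algebra_simps)

text \<open>The squared norm of the Gelfand--Tsetlin vector indexed by \<open>(a, b, c)\<close>, where
\<open>t1\<close>, \<open>t2\<close> stand for \<open>(\<alpha>\<^sub>i, \<lambda> + \<rho>)\<close>.\<close>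

definition gt_norm :: "real \<Rightarrow> real \<Rightarrow> nat \<Rightarrow> nat \<Rightarrow> nat \<Rightarrow> real" where
  "gt_norm t1 t2 a b c = fact a * fact b * fact c * falling (t1 - real b + real c) a *
     falling (t1 + t2) b * falling t1 b / falling (t1 + real c + 1) b * falling t2 c"

definition gt_up :: "real \<Rightarrow> real \<Rightarrow> real \<Rightarrow> nat \<Rightarrow> real" where
  "gt_up t1 m1 m2 b = (t1 + m2 - real b + 1) * (t1 + m2 - m1 - real b) /
     ((t1 + m2 - 2 * real b + 1) * (t1 + m2 - 2 * real b))"

text \<open>The coefficient with which E_2 takes (a, b, c) to (a + 1, b - 1, c).\<close>

definition gt_down :: "real \<Rightarrow> real \<Rightarrow> real \<Rightarrow> nat \<Rightarrow> real" where
  "gt_down t1 t2 m2 b = - real b * (t1 + t2 - real b) * (t1 - real b) /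
     ((t1 + m2 - 2 * real b + 1) * (t1 + m2 - 2 * real b))"

text \<open>The lowering operator \<open>F\<^sub>j\<close> and the raising operator \<open>E\<^sub>i\<close> on the coordinates (indexed by \<open>b\<close>) of a
vector of weight \<open>\<lambda> - m1 \<alpha>\<^sub>1 - m2 \<alpha>\<^sub>2\<close>.\<close>

definition opF :: "real \<Rightarrow> nat \<Rightarrow> real \<Rightarrow> real \<Rightarrow> (nat \<Rightarrow> real) \<Rightarrow> nat \<Rightarrow> real" where
  "opF t1 j m1 m2 \<phi> b = (if j = 1 then \<phi> b
     else gt_up t1 m1 m2 b * \<phi> b - (if b = 0 then 0 else (m1 - b + 1) * \<phi> (b - 1)))"

definition opE :: "real \<Rightarrow> real \<Rightarrow> nat \<Rightarrow> real \<Rightarrow> real \<Rightarrow> (nat \<Rightarrow> real) \<Rightarrow> nat \<Rightarrow> real" where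
  "opE t1 t2 i m1 m2 \<phi> b = (if i = 1 then (m1 - b) * (t1 + m2 - m1 - b) * \<phi> b
     else (m2 - b) * (t2 - m2 + b) * \<phi> b + gt_down t1 t2 m2 (Suc b) * \<phi> (Suc b))"

section \<open>The commutation relations in the model\<close>

lemma nonint_shift_nz:
  assumes "t \<notin> \<int>"
  shows "t + real m - real b \<noteq> 0" "t + real m - 2 * real b + 1 \<noteq> 0"
    "t + real m - 2 * real b \<noteq> 0" "t + real m - 2 * real b - 1 \<noteq> 0" "t + real m - 2 * real b + 2 \<noteq> 0"
proof -
  have "t + of_int k \<noteq> 0" for k using assms by (metis Ints_minus Ints_of_int add.inverse_inverse add_eq_0_iff)
  from this[of "int m - int b"] this[of "int m - 2 * int b + 1"] this[of "int m - 2 * int b"] this[of "int m - 2 * int b - 1"] this[of "int m - 2 * int b + 2"]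
  show "t + real m - real b \<noteq> 0" "t + real m - 2 * real b + 1 \<noteq> 0"
    "t + real m - 2 * real b \<noteq> 0" "t + real m - 2 * real b - 1 \<noteq> 0" "t + real m - 2 * real b + 2 \<noteq> 0" by (simp_all add: algebra_simps)
qed

text \<open>Together with the next three lemmas this is [E_i, F_j] = delta_ij H_i, where H_1 acts by
  t1 - 1 - 2 m1 + m2 and H_2 by t2 - 1 + m1 - 2 m2. The degrees passed to the operators are real, so
  lowering a degree 0 is not truncated.\<close>

lemma opE_opF_21:
  "opE t1 t2 2 (m1 + 1) m2 (opF t1 1 m1 m2 \<phi>) b = opF t1 1 m1 (m2 - 1) (opE t1 t2 2 m1 m2 \<phi>) b"
  by (simp add: opE_def opF_def)

lemma opE_opF_11:
  "opE t1 t2 1 (m1 + 1) m2 (opF t1 1 m1 m2 \<phi>) b = opF t1 1 (m1 - 1) m2 (opE t1 t2 1 m1 m2 \<phi>) b + (t1 - 1 - 2 * m1 + m2) * \<phi> b"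
  by (simp add: opE_def opF_def algebra_simps)

lemma opE_opF_12:
  assumes "t1 \<notin> \<int>"
  shows "opE t1 t2 1 m1 (real m2 + 1) (opF t1 2 m1 m2 \<phi>) b = opF t1 2 (m1 - 1) m2 (opE t1 t2 1 m1 m2 \<phi>) b"
  using nonint_shift_nz[OF assms, of m2 b]
  by (cases b) (simp_all add: opE_def opF_def gt_up_def field_simps)

lemma opE_opF_22:
  assumes "t1 \<notin> \<int>"
  shows "opE t1 t2 2 m1 (real m2 + 1) (opF t1 2 m1 m2 \<phi>) b =
    opF t1 2 m1 (real m2 - 1) (opE t1 t2 2 m1 m2 \<phi>) b + (t2 - 1 + m1 - 2 * real m2) * \<phi> b"
proof -
  \<comment> \<open>With this variable every denominator is a product of two consecutive terms among
    s - 1, s and s + 1.\<close>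
  define s where "s = t1 + real m2 - 2 * real b"
  have s: "t1 = s - real m2 + 2 * real b" by (simp add: s_def)
  have nz: "s \<noteq> 0" "s + 1 \<noteq> 0" "s - 1 \<noteq> 0" "s + 2 \<noteq> 0"
    using nonint_shift_nz[OF assms, of m2 b] by (simp_all add: s_def)
  \<comment> \<open>The coefficients of \<phi> (b + 1) on the two sides.\<close>
  have a: "gt_down t1 t2 (real m2 + 1) (Suc b) * gt_up t1 m1 m2 (Suc b) = gt_up t1 m1 (real m2 - 1) b * gt_down t1 t2 m2 (Suc b)"
    using nz by (simp add: gt_down_def gt_up_def s)
  have up: "gt_up t1 m1 m2 b * ((s + 1) * s) = (s + b + 1) * (s + b - m1)"
  proof -
    have "t1 + real m2 - 2 * real b + 1 = s + 1" "t1 + real m2 - 2 * real b = s" "t1 + real m2 - b + 1 = s + b + 1"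
      "t1 + real m2 - m1 - b = s + b - m1" by (simp_all add: s)
    note E = this
    show ?thesis unfolding gt_up_def E using nz by simp
  qed
  have up': "gt_up t1 m1 (real m2 - 1) b * (s * (s - 1)) = (s + b) * (s + b - 1 - m1)"
  proof -
    have "t1 + (real m2 - 1) - 2 * real b + 1 = s" "t1 + (real m2 - 1) - 2 * real b = s - 1" "t1 + (real m2 - 1) - b + 1 = s + b"
      "t1 + (real m2 - 1) - m1 - b = s + b - 1 - m1" by (simp_all add: s)
    note E = this
    show ?thesis unfolding gt_up_def E using nz by simp
  qed
  have down: "gt_down t1 t2 m2 b * ((s + 1) * s) = - b * (t1 + t2 - b) * (t1 - b)"
  proof -
    have "t1 + real m2 - 2 * real b + 1 = s + 1" "t1 + real m2 - 2 * real b = s" by (simp_all add: s)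
    note E = this
    show ?thesis unfolding gt_down_def E using nz by simp
  qed
  have down': "gt_down t1 t2 (real m2 + 1) (Suc b) * (s * (s - 1)) = - Suc b * (t1 + t2 - Suc b) * (t1 - Suc b)"
  proof -
    have "t1 + (real m2 + 1) - 2 * real (Suc b) + 1 = s" "t1 + (real m2 + 1) - 2 * real (Suc b) = s - 1" by (simp_all add: s)
    note E = this
    show ?thesis unfolding gt_down_def E using nz by simp
  qed
  \<comment> \<open>The coefficients of \<phi> b, where H_2 appears; the identity is checked after
    multiplication by s (s + 1) (s - 1).\<close>
  have c: "(real m2 + 1 - b) * (t2 - (real m2 + 1) + b) * gt_up t1 m1 m2 b - gt_down t1 t2 (real m2 + 1) (Suc b) * (m1 - b) =
     gt_up t1 m1 (real m2 - 1) b * ((real m2 - b) * (t2 - real m2 + b)) - (m1 - b + 1) * gt_down t1 t2 m2 b + (t2 - 1 + m1 - 2 * real m2)"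
    (is "?A * ?U - ?D' * ?B = ?U' * ?A' - ?B' * ?D + ?H")
  proof -
    have "(?A * ?U - ?D' * ?B - (?U' * ?A' - ?B' * ?D + ?H)) * (s * (s + 1) * (s - 1)) =
      ?A * (?U * ((s + 1) * s)) * (s - 1) - (?D' * (s * (s - 1))) * ?B * (s + 1) -
      ((?U' * (s * (s - 1))) * ?A' * (s + 1) - ?B' * (?D * ((s + 1) * s)) * (s - 1) + ?H * (s * (s + 1) * (s - 1)))"
      by (simp only: algebra_simps)
    also have "\<dots> = 0"
      unfolding up up' down down' unfolding s by (simp add: algebra_simps)
    finally show ?thesis using nz by simp
  qed
  \<comment> \<open>The contribution of \<phi> (b - 1), which is absent for b = 0.\<close>
  define T where "T = (if b = 0 then 0 else (m1 - b + 1) * \<phi> (b - 1))"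
  have T: "(if b = 0 then 0 else (m1 - b + 1) * ((real m2 - real (b - 1)) * (t2 - real m2 + real (b - 1)) * \<phi> (b - 1)
      + gt_down t1 t2 m2 (Suc (b - 1)) * \<phi> (Suc (b - 1)))) =
    (real m2 + 1 - b) * (t2 - (real m2 + 1) + b) * T + (m1 - b + 1) * gt_down t1 t2 m2 b * \<phi> b"
  proof (cases b)
    case 0
    then show ?thesis by (simp add: T_def gt_down_def)
  next
    case (Suc k)
    then show ?thesis by (simp add: T_def distrib_left mult_ac) (simp add: algebra_simps)
  qed
  let ?L = "(real m2 + 1 - b) * (t2 - (real m2 + 1) + b) * (gt_up t1 m1 m2 b * \<phi> b - T) +
    gt_down t1 t2 (real m2 + 1) (Suc b) * (gt_up t1 m1 m2 (Suc b) * \<phi> (Suc b) - (m1 - b) * \<phi> b)"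
  let ?R = "gt_up t1 m1 (real m2 - 1) b * ((real m2 - b) * (t2 - real m2 + b) * \<phi> b + gt_down t1 t2 m2 (Suc b) * \<phi> (Suc b))
    - ((real m2 + 1 - b) * (t2 - (real m2 + 1) + b) * T + (m1 - b + 1) * gt_down t1 t2 m2 b * \<phi> b)
    + (t2 - 1 + m1 - 2 * real m2) * \<phi> b"
  have "?L = ((real m2 + 1 - b) * (t2 - (real m2 + 1) + b) * gt_up t1 m1 m2 b - gt_down t1 t2 (real m2 + 1) (Suc b) * (m1 - b)) * \<phi> b
     + (gt_down t1 t2 (real m2 + 1) (Suc b) * gt_up t1 m1 m2 (Suc b)) * \<phi> (Suc b)
     - (real m2 + 1 - b) * (t2 - (real m2 + 1) + b) * T"
    by (simp only: algebra_simps)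
  also have "\<dots> = ?R" unfolding a c by (simp only: algebra_simps)
  finally have "?L = ?R" .
  moreover have "opE t1 t2 2 m1 (real m2 + 1) (opF t1 2 m1 m2 \<phi>) b = ?L"
    by (simp add: opE_def opF_def T_def)
  moreover have "opF t1 2 m1 (real m2 - 1) (opE t1 t2 2 m1 m2 \<phi>) b + (t2 - 1 + m1 - 2 * real m2) * \<phi> b = ?R"
    unfolding T[symmetric] by (simp add: opE_def opF_def)
  ultimately show ?thesis by simp
qed

section \<open>Words as coordinate vectors in the Gelfand--Tsetlin basis\<close>

fun gt_vec :: "real \<Rightarrow> nat list \<Rightarrow> nat \<Rightarrow> real" where
  "gt_vec t1 [] = (\<lambda>b. if b = 0 then 1 else 0)"
| "gt_vec t1 (j # w) = opF t1 j (count_list w 1) (count_list w 2) (gt_vec t1 w)"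

lemma gt_vec_zero:
  "set w \<subseteq> {1,2} \<Longrightarrow> count_list w 1 < b \<or> count_list w 2 < b \<Longrightarrow> gt_vec t1 w b = 0"
proof (induction w arbitrary: b)
  case (Cons j w)
  consider "j = 1" | "j = 2" using Cons.prems(1) by auto
  then show ?case
  proof cases
    case 1
    then show ?thesis using Cons by (auto simp: opF_def)
  next
    case 2
    \<comment> \<open>At b = m1 + 1 the entry at b - 1 need not vanish, but its coefficient m1 - b +
      1 does.\<close>
    have "(real (count_list w 1) - b + 1) * gt_vec t1 w (b - 1) = 0" if "b \<noteq> 0"
    proof (cases "b = count_list w 1 + 1")
      case False
      then have "gt_vec t1 w (b - 1) = 0" using Cons that 2 by (intro Cons.IH) auto
      then show ?thesis by simp
    qed simp
    moreover have "gt_vec t1 w b = 0" using Cons 2 by (intro Cons.IH) auto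
    ultimately show ?thesis using 2 by (simp add: opF_def)
  qed
qed auto

text \<open>The result of moving E_i to the right through the word v, as in the recursion of
  \<open>shap\<close>: a sum over the removed letters, weighted by \<open>h\<close> of the letters
  to their right.\<close>

definition removal_sum :: "(nat list \<Rightarrow> real) \<Rightarrow> (nat list \<Rightarrow> nat \<Rightarrow> real) \<Rightarrow> nat \<Rightarrow> nat list \<Rightarrow> nat \<Rightarrow> real" where
  "removal_sum h \<psi> i v b = (\<Sum>p<length v. if v ! p = i then h (drop (Suc p) v) * \<psi> (take p v @ drop (Suc p) v) b else 0)"

lemma opF_sum:
  "opF t1 j m1 m2 (\<lambda>b. \<Sum>p\<in>I. c p * \<psi> p b) b = (\<Sum>p\<in>I. c p * opF t1 j m1 m2 (\<psi> p) b)"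
  by (simp add: opF_def sum_distrib_left sum_subtractf right_diff_distrib mult_ac)

lemma count_list_remove:
  assumes "p < length v"
  shows "count_list v k = count_list (take p v @ drop (Suc p) v) k + (if v ! p = k then 1 else 0)"
  by (subst id_take_nth_drop[OF assms]) simp

text \<open>Induction along E_i F_j w = F_j E_i w + delta_ij H_i w: the second term removes the
  first letter, the first term one of the others. Here \<open>h i w\<close> is the eigenvalue of H_i
  on the word w.\<close>

lemma removal_sum_gt_vec:
  fixes t1 t2 :: real
  defines "h \<equiv> \<lambda>i w. if i = 1 then t1 - 1 - 2 * real (count_list w 1) + real (count_list w 2)
    else t2 - 1 + real (count_list w 1) - 2 * real (count_list w 2)"
  assumes t1: "t1 \<notin> \<int>" and i: "i \<in> {1,2}"
  shows "set v \<subseteq> {1,2} \<Longrightarrow> removal_sum (h i) (gt_vec t1) i v b =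
    opE t1 t2 i (count_list v 1) (count_list v 2) (gt_vec t1 v) b"
proof (induction v arbitrary: b)
  case Nil
  then show ?case by (cases b) (simp_all add: removal_sum_def opE_def)
next
  case (Cons j v)
  let ?m1 = "real (count_list v 1)" and ?m2 = "real (count_list v 2)"
  let ?d1 = "if i = 1 then 1 else 0 :: real" and ?d2 = "if i = 1 then 0 else 1 :: real"
  have IH: "removal_sum (h i) (gt_vec t1) i v = opE t1 t2 i ?m1 ?m2 (gt_vec t1 v)"
    using Cons by (intro ext) auto
  have "removal_sum (h i) (gt_vec t1) i (j # v) b = (if j = i then h i v * gt_vec t1 v b else 0) +
     (\<Sum>p<length v. if v ! p = i then h i (drop (Suc p) v) * gt_vec t1 (j # take p v @ drop (Suc p) v) b else 0)"
    unfolding removal_sum_def by (simp only: list.size add_Suc_right add_0_right sum.lessThan_Suc_shift) (simp cong: if_cong)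
  also have "(\<Sum>p<length v. if v ! p = i then h i (drop (Suc p) v) * gt_vec t1 (j # take p v @ drop (Suc p) v) b else 0) =
    (\<Sum>p<length v. (if v ! p = i then h i (drop (Suc p) v) else 0) * opF t1 j (?m1 - ?d1) (?m2 - ?d2) (gt_vec t1 (take p v @ drop (Suc p) v)) b)"
  proof (intro sum.cong refl)
    fix p assume "p \<in> {..<length v}"
    then have p: "p < length v" by simp
    show "(if v ! p = i then h i (drop (Suc p) v) * gt_vec t1 (j # take p v @ drop (Suc p) v) b else 0) =
      (if v ! p = i then h i (drop (Suc p) v) else 0) * opF t1 j (?m1 - ?d1) (?m2 - ?d2) (gt_vec t1 (take p v @ drop (Suc p) v)) b"
    proof (cases "v ! p = i")
      case True
      have "real (count_list (take p v @ drop (Suc p) v) 1) = ?m1 - ?d1" "real (count_list (take p v @ drop (Suc p) v) 2) = ?m2 - ?d2"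
        using count_list_remove[OF p, of 1] count_list_remove[OF p, of 2] True i by auto
      then show ?thesis using True by simp
    qed simp
  qed
  also have "\<dots> = opF t1 j (?m1 - ?d1) (?m2 - ?d2) (removal_sum (h i) (gt_vec t1) i v) b"
    unfolding removal_sum_def opF_sum[symmetric] by (intro arg_cong2[where f = "opF t1 j (?m1 - ?d1) (?m2 - ?d2)"] ext refl sum.cong) auto
  also have "\<dots> = opF t1 j (?m1 - ?d1) (?m2 - ?d2) (opE t1 t2 i ?m1 ?m2 (gt_vec t1 v)) b"
    unfolding IH ..
  finally have *: "removal_sum (h i) (gt_vec t1) i (j # v) b = (if j = i then h i v * gt_vec t1 v b else 0) + \<dots>" .
  have j: "j = 1 \<or> j = 2" using Cons.prems by auto
  have i': "i = 1 \<or> i = 2" using i by auto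
  from i' j show ?case unfolding *
    using opE_opF_11[of t1 t2 ?m1 ?m2 "gt_vec t1 v" b] opE_opF_21[of t1 t2 ?m1 ?m2 "gt_vec t1 v" b]
      opE_opF_12[OF t1, of t2 ?m1 "count_list v 2" "gt_vec t1 v" b] opE_opF_22[OF t1, of t2 ?m1 "count_list v 2" "gt_vec t1 v" b]
    by (elim disjE) (simp_all add: h_def add.commute)
qed


section \<open>Norm recursions and adjointness\<close>

lemma gt_norm_0: "gt_norm t1 t2 0 0 0 = 1"
  by (simp add: gt_norm_def)

lemma falling_nz: "(\<And>i. i < n \<Longrightarrow> s \<noteq> real (Suc i)) \<Longrightarrow> falling s n \<noteq> 0"
  by (simp add: falling_def)

lemma nonint_shift_falling_nz: "t1 \<notin> \<int> \<Longrightarrow> falling (t1 + real c + 1) n \<noteq> 0"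
proof (rule falling_nz)
  fix i assume "t1 \<notin> \<int>"
  then show "t1 + real c + 1 \<noteq> real (Suc i)"
    using nonint_shift_nz(1)[of t1 c i] by auto
qed

lemma gt_norm_Suc_a:
  "gt_norm t1 t2 (Suc a) b c = (real a + 1) * (t1 + real c - real b - real a - 1) * gt_norm t1 t2 a b c"
  by (simp add: gt_norm_def falling_Suc algebra_simps add_divide_distrib diff_divide_distrib)

text \<open>Adjointness on the pair (a, b, c), (a, b, c + 1): the left factor is the coefficient of
  E_2 from the second to the first, the right one that of F_2 back.\<close>

lemma gt_norm_Suc_c:
  assumes "t1 \<notin> \<int>"
  shows "(real c + 1) * (t2 - real c - 1) * gt_norm t1 t2 a b c =
    gt_norm t1 t2 a b (Suc c) * ((t1 + c + 1) * (t1 + real c - real b - real a) / ((t1 + real c - real b + 1) * (t1 + real c - real b)))"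
proof -
  let ?s = "t1 - real b + real c" and ?r = "t1 + real c + 1"
  have nz: "?s \<noteq> 0" "?s + 1 \<noteq> 0" "falling ?r b \<noteq> 0" "falling (?r + 1) b \<noteq> 0" "?r \<noteq> 0"
    using nonint_shift_nz(1)[OF assms, of c b] nonint_shift_nz(1)[OF assms, of "Suc c" b] nonint_shift_nz(1)[OF assms, of "Suc c" 0]
      nonint_shift_falling_nz[OF assms, of c b] nonint_shift_falling_nz[OF assms, of "Suc c" b]
    by (simp_all add: algebra_simps)
  define K where "K = fact a * fact b * fact c * falling (t1 + t2) b * falling t1 b * falling t2 c"
  have 1: "gt_norm t1 t2 a b c = K * falling ?s a / falling ?r b"
    by (simp add: gt_norm_def K_def)
  have 2: "gt_norm t1 t2 a b (Suc c) = K * (real c + 1) * (t2 - real c - 1) * (falling (?s + 1) a / falling (?r + 1) b)"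
    by (simp add: gt_norm_def K_def falling_Suc add_ac mult_ac)
  have 3: "falling (?s + 1) a * (?s - real a) = ?s * falling ?s a" using falling_shift[of ?s a] by (simp add: mult_ac)
  have 4: "falling (?r + 1) b * (?s + 1) = ?r * falling ?r b" using falling_shift[of ?r b] by (simp add: algebra_simps)
  have "falling (?s + 1) a / falling (?r + 1) b * (?r * (?s - real a) / ((?s + 1) * ?s)) =
    (falling (?s + 1) a * (?s - real a)) * ?r / ((falling (?r + 1) b * (?s + 1)) * ?s)"
    by (simp add: mult_ac)
  also have "\<dots> = falling ?s a / falling ?r b"
    unfolding 3 4 using nz by simp
  finally have 5: "falling (?s + 1) a / falling (?r + 1) b * (?r * (?s - real a) / ((?s + 1) * ?s)) = falling ?s a / falling ?r b" .
  have 6: "(t1 + c + 1) * (t1 + real c - real b - real a) / ((t1 + real c - real b + 1) * (t1 + real c - real b)) =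
     ?r * (?s - real a) / ((?s + 1) * ?s)" by (simp add: algebra_simps)
  have "gt_norm t1 t2 a b (Suc c) * ((t1 + c + 1) * (t1 + real c - real b - real a) / ((t1 + real c - real b + 1) * (t1 + real c - real b))) =
    K * (real c + 1) * (t2 - real c - 1) * (falling (?s + 1) a / falling (?r + 1) b * (?r * (?s - real a) / ((?s + 1) * ?s)))"
    unfolding 2 6 by (rule mult.assoc)
  also have "\<dots> = K * (real c + 1) * (t2 - real c - 1) * (falling ?s a / falling ?r b)" unfolding 5 ..
  finally show ?thesis by (simp add: 1)
qed

text \<open>Adjointness on the pair (a + 1, b, c), (a, b + 1, c). The coefficients of E_2 and F_2
  between them are both negated here.\<close>

lemma gt_norm_Suc_b:
  assumes "t1 \<notin> \<int>"
  shows "gt_norm t1 t2 (Suc a) b c * (real b + 1) * (t1 + t2 - real b - 1) * (t1 - real b - 1) /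
     ((t1 + real c - real b) * (t1 + real c - real b - 1)) = gt_norm t1 t2 a (Suc b) c * (real a + 1)"
proof -
  let ?s = "t1 - real b + real c" and ?r = "t1 + real c + 1"
  have nz: "?s \<noteq> 0" "?s - 1 \<noteq> 0" "falling ?r b \<noteq> 0"
    using nonint_shift_nz(1)[OF assms, of c b] nonint_shift_nz(1)[OF assms, of c "Suc b"]
      nonint_shift_falling_nz[OF assms, of c b]
    by (simp_all add: algebra_simps)
  have f: "falling ?s (Suc a) = (?s - 1) * falling (?s - 1) a"
    using falling_add[of ?s 1 a] by (simp add: falling_Suc)
  define K where "K = fact a * fact b * fact c * falling (t1 + t2) b * falling t1 b * falling t2 c * (real a + 1) * (real b + 1) * (t1 + t2 - real b - 1) * (t1 - real b - 1)"
  have "gt_norm t1 t2 (Suc a) b c * (real b + 1) * (t1 + t2 - real b - 1) * (t1 - real b - 1) = K * ((?s - 1) * falling (?s - 1) a) / falling ?r b"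
    unfolding gt_norm_def f by (simp add: K_def mult_ac)
  moreover have "gt_norm t1 t2 a (Suc b) c * (real a + 1) = K * falling (?s - 1) a / (falling ?r b * ?s)"
    by (simp add: gt_norm_def K_def falling_Suc algebra_simps)
  moreover have "(t1 + real c - real b) * (t1 + real c - real b - 1) = ?s * (?s - 1)" by (simp add: algebra_simps)
  ultimately show ?thesis using nz by simp
qed


definition gt_form :: "real \<Rightarrow> real \<Rightarrow> nat \<Rightarrow> nat \<Rightarrow> (nat \<Rightarrow> real) \<Rightarrow> (nat \<Rightarrow> real) \<Rightarrow> real" where
  "gt_form t1 t2 m1 m2 \<phi> \<psi> = (\<Sum>b\<le>min m1 m2. gt_norm t1 t2 (m1 - b) b (m2 - b) * \<phi> b * \<psi> b)"

text \<open>The two sides of an adjointness relation live in different degrees; a common range of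
  summation allows comparison term by term.\<close>

lemma gt_form_extend:
  assumes "\<And>b. m1 < b \<or> m2 < b \<Longrightarrow> \<phi> b * \<psi> b = 0" "min m1 m2 \<le> K"
  shows "gt_form t1 t2 m1 m2 \<phi> \<psi> = (\<Sum>b\<le>K. gt_norm t1 t2 (m1 - b) b (m2 - b) * \<phi> b * \<psi> b)"
  unfolding gt_form_def
proof (rule sum.mono_neutral_left)
  show "\<forall>i\<in>{..K} - {..min m1 m2}. gt_norm t1 t2 (m1 - i) i (m2 - i) * \<phi> i * \<psi> i = 0"
  proof
    fix b assume "b \<in> {..K} - {..min m1 m2}"
    then have "\<phi> b * \<psi> b = 0" by (intro assms(1)) auto
    then show "gt_norm t1 t2 (m1 - b) b (m2 - b) * \<phi> b * \<psi> b = 0" by auto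
  qed
qed (use assms(2) in auto)

lemma gt_form_adjoint_1:
  assumes "\<And>b. m1 < b \<or> m2 < b \<Longrightarrow> \<phi> b = 0"
  shows "gt_form t1 t2 m1 m2 \<phi> (opE t1 t2 1 (Suc m1) m2 \<psi>) = gt_form t1 t2 (Suc m1) m2 (opF t1 1 m1 m2 \<phi>) \<psi>"
proof -
  let ?K = "m1 + m2"
  have "gt_form t1 t2 m1 m2 \<phi> (opE t1 t2 1 (Suc m1) m2 \<psi>) =
    (\<Sum>b\<le>?K. gt_norm t1 t2 (m1 - b) b (m2 - b) * \<phi> b * opE t1 t2 1 (Suc m1) m2 \<psi> b)"
    by (rule gt_form_extend) (use assms in auto)
  also have "\<dots> = (\<Sum>b\<le>?K. gt_norm t1 t2 (Suc m1 - b) b (m2 - b) * \<phi> b * \<psi> b)"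
  proof (intro sum.cong refl)
    fix b
    show "gt_norm t1 t2 (m1 - b) b (m2 - b) * \<phi> b * opE t1 t2 1 (Suc m1) m2 \<psi> b = gt_norm t1 t2 (Suc m1 - b) b (m2 - b) * \<phi> b * \<psi> b"
    proof (cases "m1 < b \<or> m2 < b")
      case False
      then have "gt_norm t1 t2 (Suc m1 - b) b (m2 - b) = (real (Suc m1) - real b) * (t1 + real m2 - real (Suc m1) - real b) * gt_norm t1 t2 (m1 - b) b (m2 - b)"
        by (simp add: Suc_diff_le gt_norm_Suc_a of_nat_diff algebra_simps)
      then show ?thesis by (simp add: opE_def)
    qed (use assms in simp)
  qed
  also have "\<dots> = gt_form t1 t2 (Suc m1) m2 \<phi> \<psi>"
    by (rule gt_form_extend[symmetric]) (use assms in auto)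
  finally show ?thesis by (simp add: opF_def[abs_def])
qed

lemma gt_form_adjoint_2:
  assumes t1: "t1 \<notin> \<int>" and \<phi>: "\<And>b. m1 < b \<or> m2 < b \<Longrightarrow> \<phi> b = 0"
    and \<psi>: "\<And>b. m1 < b \<or> Suc m2 < b \<Longrightarrow> \<psi> b = 0"
  shows "gt_form t1 t2 m1 m2 \<phi> (opE t1 t2 2 m1 (Suc m2) \<psi>) = gt_form t1 t2 m1 (Suc m2) (opF t1 2 m1 m2 \<phi>) \<psi>"
proof -
  let ?K = "m1 + m2"
  let ?N = "\<lambda>b. gt_norm t1 t2 (m1 - b) b (m2 - b)" and ?N' = "\<lambda>b. gt_norm t1 t2 (m1 - b) b (Suc m2 - b)"
  have up: "?N b * ((real (Suc m2) - b) * (t2 - real (Suc m2) + b)) = ?N' b * gt_up t1 m1 m2 b" if "b \<le> m1" "b \<le> m2" for b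
  proof -
    obtain a c where ac: "m1 = b + a" "m2 = b + c" using \<open>b \<le> m1\<close> \<open>b \<le> m2\<close> by (metis le_iff_add)
    have "gt_up t1 m1 m2 b = (t1 + c + 1) * (t1 + real c - real b - real a) / ((t1 + real c - real b + 1) * (t1 + real c - real b))"
      by (simp add: gt_up_def ac algebra_simps)
    moreover have "real (Suc m2) - b = real c + 1" "t2 - real (Suc m2) + b = t2 - real c - 1" by (simp_all add: ac)
    moreover have "m1 - b = a" "m2 - b = c" "Suc m2 - b = Suc c" by (simp_all add: ac)
    ultimately show ?thesis using gt_norm_Suc_c[OF t1, of c t2 a b] by (simp only: mult_ac)
  qed
  have down: "?N b * gt_down t1 t2 (Suc m2) (Suc b) = - ?N' (Suc b) * (m1 - b)" if "b < m1" "b \<le> m2" for b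
  proof -
    obtain a c where ac: "m1 = b + Suc a" "m2 = b + c"
      using \<open>b < m1\<close> \<open>b \<le> m2\<close> by (metis add_Suc_right le_iff_add less_iff_Suc_add)
    have "gt_down t1 t2 (Suc m2) (Suc b) = - ((real b + 1) * (t1 + t2 - real b - 1) * (t1 - real b - 1) / ((t1 + real c - real b) * (t1 + real c - real b - 1)))"
    proof -
      have "t1 + real (Suc m2) - 2 * real (Suc b) + 1 = t1 + real c - real b"
        "t1 + real (Suc m2) - 2 * real (Suc b) = t1 + real c - real b - 1"
        "real b + 1 = real (Suc b)" "t1 + t2 - real b - 1 = t1 + t2 - real (Suc b)" "t1 - real b - 1 = t1 - real (Suc b)"
        by (simp_all add: ac)
      note E = this
      show ?thesis unfolding gt_down_def E by (simp only: mult_minus_left minus_divide_left diff_add_cancel)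
    qed
    moreover have "m1 - b = Suc a" "m1 - Suc b = a" "m2 - b = c" "Suc m2 - Suc b = c" by (simp_all add: ac)
    ultimately show ?thesis using gt_norm_Suc_b[OF t1, of t2 a b c] by (simp add: mult.assoc)
  qed
  have "gt_form t1 t2 m1 m2 \<phi> (opE t1 t2 2 m1 (Suc m2) \<psi>) = (\<Sum>b\<le>?K. ?N b * \<phi> b * opE t1 t2 2 m1 (Suc m2) \<psi> b)"
    by (rule gt_form_extend) (use \<phi> in auto)
  also have "\<dots> = (\<Sum>b\<le>?K. ?N b * ((real (Suc m2) - b) * (t2 - real (Suc m2) + b)) * \<phi> b * \<psi> b)
    + (\<Sum>b\<le>?K. ?N b * gt_down t1 t2 (Suc m2) (Suc b) * \<phi> b * \<psi> (Suc b))"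
    unfolding sum.distrib[symmetric] by (intro sum.cong refl) (simp add: opE_def algebra_simps)
  also have "(\<Sum>b\<le>?K. ?N b * ((real (Suc m2) - b) * (t2 - real (Suc m2) + b)) * \<phi> b * \<psi> b) =
     (\<Sum>b\<le>?K. ?N' b * (gt_up t1 m1 m2 b * \<phi> b) * \<psi> b)"
  proof (intro sum.cong refl)
    fix b
    show "?N b * ((real (Suc m2) - b) * (t2 - real (Suc m2) + b)) * \<phi> b * \<psi> b = ?N' b * (gt_up t1 m1 m2 b * \<phi> b) * \<psi> b"
      using up[of b] \<phi>[of b] by (cases "m1 < b \<or> m2 < b") (auto simp: mult.assoc)
  qed
  \<comment> \<open>The added term is zero; it makes the range agree with that of the other sum
    after its shift from b to b + 1.\<close>
  also have "(\<Sum>b\<le>?K. ?N' b * (gt_up t1 m1 m2 b * \<phi> b) * \<psi> b) = (\<Sum>b\<le>Suc ?K. ?N' b * (gt_up t1 m1 m2 b * \<phi> b) * \<psi> b)"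
    using \<phi>[of "Suc ?K"] by simp
  also have "(\<Sum>b\<le>?K. ?N b * gt_down t1 t2 (Suc m2) (Suc b) * \<phi> b * \<psi> (Suc b)) =
    - (\<Sum>b\<le>?K. ?N' (Suc b) * ((real m1 - b) * \<phi> b) * \<psi> (Suc b))"
    unfolding sum_negf[symmetric]
  proof (intro sum.cong refl)
    fix b
    show "?N b * gt_down t1 t2 (Suc m2) (Suc b) * \<phi> b * \<psi> (Suc b) = - (?N' (Suc b) * ((real m1 - b) * \<phi> b) * \<psi> (Suc b))"
      using down[of b] \<phi>[of b] \<psi>[of "Suc b"] by (cases "b < m1 \<and> b \<le> m2") (auto simp: of_nat_diff)
  qed
  also have "(\<Sum>b\<le>?K. ?N' (Suc b) * ((real m1 - b) * \<phi> b) * \<psi> (Suc b)) =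
    (\<Sum>b\<le>Suc ?K. ?N' b * (if b = 0 then 0 else (real m1 - b + 1) * \<phi> (b - 1)) * \<psi> b)"
    by (subst sum.atMost_Suc_shift) (simp add: algebra_simps)
  also have "(\<Sum>b\<le>Suc ?K. ?N' b * (gt_up t1 m1 m2 b * \<phi> b) * \<psi> b) + - \<dots> =
    (\<Sum>b\<le>Suc ?K. ?N' b * opF t1 2 m1 m2 \<phi> b * \<psi> b)"
    by (simp add: opF_def right_diff_distrib left_diff_distrib sum_subtractf del: sum.atMost_Suc)
  also have "\<dots> = gt_form t1 t2 m1 (Suc m2) (opF t1 2 m1 m2 \<phi>) \<psi>"
    by (rule gt_form_extend[symmetric]) (use \<psi> in auto)
  finally show ?thesis .
qed


section \<open>Identification of the Shapovalov form\<close>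

lemma A2_form_root_word_wt:
  "A2_form (A2_root 1) (word_wt lam w) = 2 * fst lam - snd lam - 2 * real (count_list w 1) + real (count_list w 2)"
  "A2_form (A2_root 2) (word_wt lam w) = 2 * snd lam - fst lam + real (count_list w 1) - 2 * real (count_list w 2)"
  by (simp_all add: A2_form_def A2_root_def word_wt_def algebra_simps)

text \<open>Both forms obey the same recursion: the first letter F_i of u is moved to the other side
  as E_i, where \<open>removal_sum_gt_vec\<close> identifies the sum over positions with
  \<open>opE\<close>.\<close>

theorem shap_eq_gt_form:
  fixes lam :: wt
  defines "t1 \<equiv> 2 * fst lam - snd lam + 1" and "t2 \<equiv> 2 * snd lam - fst lam + 1"
  assumes t1: "t1 \<notin> \<int>"
  shows "set u \<subseteq> {1,2} \<Longrightarrow> set v \<subseteq> {1,2} \<Longrightarrow> shap lam u v =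
    (if count_list u 1 = count_list v 1 \<and> count_list u 2 = count_list v 2
     then gt_form t1 t2 (count_list u 1) (count_list u 2) (gt_vec t1 u) (gt_vec t1 v) else 0)"
proof (induction u arbitrary: v)
  case Nil
  show ?case
  proof (cases v)
    case Nil
    then show ?thesis by (simp add: gt_form_def gt_norm_0)
  next
    case (Cons j w)
    then show ?thesis using Nil.prems by auto
  qed
next
  case (Cons i u)
  let ?m1 = "count_list u 1" and ?m2 = "count_list u 2"
  have i: "i \<in> {1,2}" and u: "set u \<subseteq> {1,2}" using Cons.prems(1) by auto
  let ?h = "\<lambda>w. if i = 1 then t1 - 1 - 2 * real (count_list w 1) + real (count_list w 2)
    else t2 - 1 + real (count_list w 1) - 2 * real (count_list w 2)"
  have h: "A2_form (A2_root i) (word_wt lam w) = ?h w" for w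
    using i by (auto simp: A2_form_root_word_wt[unfolded One_nat_def] t1_def t2_def)
  let ?ok = "count_list (i # u) 1 = count_list v 1 \<and> count_list (i # u) 2 = count_list v 2"
  have rem: "shap lam u (take p v @ drop (Suc p) v) = (if ?ok then gt_form t1 t2 ?m1 ?m2 (gt_vec t1 u) (gt_vec t1 (take p v @ drop (Suc p) v)) else 0)"
    if p: "p < length v" "v ! p = i" for p
  proof -
    have "set (take p v @ drop (Suc p) v) \<subseteq> {1,2}"
      using Cons.prems(2) by (auto dest: in_set_takeD in_set_dropD)
    then show ?thesis
      using Cons.IH[OF u, of "take p v @ drop (Suc p) v"] count_list_remove[OF p(1), of 1] count_list_remove[OF p(1), of 2] p(2) by auto
  qed
  have "shap lam (i # u) v = (\<Sum>p<length v. if v ! p = i then ?h (drop (Suc p) v) *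
     (if ?ok then gt_form t1 t2 ?m1 ?m2 (gt_vec t1 u) (gt_vec t1 (take p v @ drop (Suc p) v)) else 0) else 0)"
    unfolding shap.simps by (intro sum.cong refl) (simp add: h rem)
  also have "\<dots> = (if ?ok then gt_form t1 t2 ?m1 ?m2 (gt_vec t1 u) (removal_sum ?h (gt_vec t1) i v) else 0)"
  proof (cases ?ok)
    case True
    have "gt_form t1 t2 ?m1 ?m2 (gt_vec t1 u) (removal_sum ?h (gt_vec t1) i v) =
      (\<Sum>b\<le>min ?m1 ?m2. \<Sum>p<length v. gt_norm t1 t2 (?m1 - b) b (?m2 - b) * gt_vec t1 u b *
        (if v ! p = i then ?h (drop (Suc p) v) * gt_vec t1 (take p v @ drop (Suc p) v) b else 0))"
      unfolding gt_form_def removal_sum_def sum_distrib_left ..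
    also have "\<dots> = (\<Sum>p<length v. \<Sum>b\<le>min ?m1 ?m2. gt_norm t1 t2 (?m1 - b) b (?m2 - b) * gt_vec t1 u b *
        (if v ! p = i then ?h (drop (Suc p) v) * gt_vec t1 (take p v @ drop (Suc p) v) b else 0))"
      by (rule sum.swap)
    also have "\<dots> = (\<Sum>p<length v. if v ! p = i then ?h (drop (Suc p) v) *
     (if ?ok then gt_form t1 t2 ?m1 ?m2 (gt_vec t1 u) (gt_vec t1 (take p v @ drop (Suc p) v)) else 0) else 0)"
    proof (intro sum.cong refl)
      fix p
      show "(\<Sum>b\<le>min ?m1 ?m2. gt_norm t1 t2 (?m1 - b) b (?m2 - b) * gt_vec t1 u b *
          (if v ! p = i then ?h (drop (Suc p) v) * gt_vec t1 (take p v @ drop (Suc p) v) b else 0)) =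
        (if v ! p = i then ?h (drop (Suc p) v) *
          (if ?ok then gt_form t1 t2 ?m1 ?m2 (gt_vec t1 u) (gt_vec t1 (take p v @ drop (Suc p) v)) else 0) else 0)"
        unfolding gt_form_def if_P[OF True] sum_distrib_left
        by (cases "v ! p = i") (auto intro!: sum.cong simp: mult_ac)
    qed
    finally show ?thesis using True by (simp cong: if_cong)
  next
    case False
    then show ?thesis by (simp only: if_False mult_zero_right if_cancel sum.neutral_const)
  qed
  also have "removal_sum ?h (gt_vec t1) i v = opE t1 t2 i (count_list v 1) (count_list v 2) (gt_vec t1 v)"
    using removal_sum_gt_vec[OF t1 i Cons.prems(2), of t2] by (intro ext) simp
  also have "(if ?ok then gt_form t1 t2 ?m1 ?m2 (gt_vec t1 u) (opE t1 t2 i (count_list v 1) (count_list v 2) (gt_vec t1 v)) else 0) =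
    (if ?ok then gt_form t1 t2 (count_list (i # u) 1) (count_list (i # u) 2) (gt_vec t1 (i # u)) (gt_vec t1 v) else 0)"
  proof (cases ?ok)
    case True
    note z = gt_vec_zero[OF u] gt_vec_zero[OF Cons.prems(2)]
    consider "i = 1" | "i = 2" using i by auto
    then show ?thesis
    proof cases
      case 1
      then have "count_list v 1 = Suc ?m1" "count_list v 2 = ?m2" using True by auto
      then show ?thesis using True 1 gt_form_adjoint_1[of ?m1 ?m2 "gt_vec t1 u" t1 t2 "gt_vec t1 v"] z by simp
    next
      case 2
      then have "count_list v 1 = ?m1" "count_list v 2 = Suc ?m2" using True by auto
      then show ?thesis using True 2 gt_form_adjoint_2[OF t1, of ?m1 ?m2 "gt_vec t1 u" "gt_vec t1 v" t2] z by simp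
    qed
  next
    case False
    show ?thesis unfolding if_not_P[OF False] ..
  qed
  finally show ?case .
qed

section \<open>PBW vectors and unitriangularity\<close>

definition lc_vec :: "real \<Rightarrow> lc \<Rightarrow> nat \<Rightarrow> real" where
  "lc_vec t xs b = (\<Sum>x\<leftarrow>xs. fst x * gt_vec t (snd x) b)"

definition lc_homog :: "nat \<Rightarrow> nat \<Rightarrow> lc \<Rightarrow> bool" where
  "lc_homog m1 m2 xs \<longleftrightarrow> (\<forall>x\<in>set xs. set (snd x) \<subseteq> {1,2} \<and> count_list (snd x) 1 = m1 \<and> count_list (snd x) 2 = m2)"

lemma lc_vec_simps [simp]:
  "lc_vec t [] = (\<lambda>b. 0)"
  "lc_vec t (x # xs) = (\<lambda>b. fst x * gt_vec t (snd x) b + lc_vec t xs b)"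
  "lc_vec t (xs @ ys) = (\<lambda>b. lc_vec t xs b + lc_vec t ys b)"
  by (simp_all add: lc_vec_def fun_eq_iff)

lemma lc_homog_simps [simp]:
  "lc_homog m1 m2 []"
  "lc_homog m1 m2 (x # xs) \<longleftrightarrow> set (snd x) \<subseteq> {1,2} \<and> count_list (snd x) 1 = m1 \<and> count_list (snd x) 2 = m2 \<and> lc_homog m1 m2 xs"
  "lc_homog m1 m2 (xs @ ys) \<longleftrightarrow> lc_homog m1 m2 xs \<and> lc_homog m1 m2 ys"
  by (auto simp: lc_homog_def)

lemma gt_form_linear:
  "gt_form t1 t2 m1 m2 (\<lambda>b. c * \<phi> b + \<phi>' b) \<psi> = c * gt_form t1 t2 m1 m2 \<phi> \<psi> + gt_form t1 t2 m1 m2 \<phi>' \<psi>"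
  "gt_form t1 t2 m1 m2 \<psi> (\<lambda>b. c * \<phi> b + \<phi>' b) = c * gt_form t1 t2 m1 m2 \<psi> \<phi> + gt_form t1 t2 m1 m2 \<psi> \<phi>'"
  by (simp_all add: gt_form_def sum.distrib sum_distrib_left algebra_simps)

lemma gt_form_zero [simp]: "gt_form t1 t2 m1 m2 (\<lambda>b. 0) \<psi> = 0" "gt_form t1 t2 m1 m2 \<psi> (\<lambda>b. 0) = 0"
  by (simp_all add: gt_form_def)

lemma shap_lc_eq_gt_form:
  fixes lam :: wt
  defines "t1 \<equiv> 2 * fst lam - snd lam + 1" and "t2 \<equiv> 2 * snd lam - fst lam + 1"
  assumes t1: "t1 \<notin> \<int>" and ys: "lc_homog m1 m2 ys"
  shows "lc_homog m1 m2 xs \<Longrightarrow> shap_lc lam xs ys = gt_form t1 t2 m1 m2 (lc_vec t1 xs) (lc_vec t1 ys)"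
proof (induction xs)
  case (Cons x xs)
  have "(\<Sum>y\<leftarrow>ys. fst x * fst y * shap lam (snd x) (snd y)) = fst x * gt_form t1 t2 m1 m2 (gt_vec t1 (snd x)) (lc_vec t1 ys)"
    using ys
  proof (induction ys)
    case (Cons y ys)
    have "shap lam (snd x) (snd y) = gt_form t1 t2 m1 m2 (gt_vec t1 (snd x)) (gt_vec t1 (snd y))"
      using shap_eq_gt_form[of lam "snd x" "snd y"] t1 Cons.prems \<open>lc_homog m1 m2 (x # xs)\<close> by (simp add: t1_def t2_def)
    then show ?case using Cons by (simp add: gt_form_linear distrib_left)
  qed simp
  then show ?case using Cons by (simp add: shap_lc_def gt_form_linear)
qed (simp add: shap_lc_def)

lemma opF_linear:
  "opF t j m1 m2 (\<lambda>b. c * \<phi> b + \<psi> b) b = c * opF t j m1 m2 \<phi> b + opF t j m1 m2 \<psi> b"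
  by (simp add: opF_def algebra_simps)

lemma lc_vec_Cons_letter:
  "lc_homog m1 m2 ys \<Longrightarrow> lc_vec t (map (\<lambda>y. (s * fst y, j # snd y)) ys) b = s * opF t j m1 m2 (lc_vec t ys) b"
proof (induction ys)
  case Nil
  then show ?case by (simp add: opF_def)
next
  case (Cons y ys)
  then show ?case by (simp add: opF_linear distrib_left)
qed

lemma lc_prod_simps [simp]:
  "lc_prod [] ys = []"
  "lc_prod (x # xs) ys = map (\<lambda>y. (fst x * fst y, snd x @ snd y)) ys @ lc_prod xs ys"
  "lc_prod (xs @ xs') ys = lc_prod xs ys @ lc_prod xs' ys"
  by (simp_all add: lc_prod_def)

lemma lc_prod_assoc: "lc_prod (lc_prod xs ys) zs = lc_prod xs (lc_prod ys zs)"
proof (induction xs)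
  case (Cons x xs)
  have "lc_prod (map (\<lambda>y. (fst x * fst y, snd x @ snd y)) ys) zs = map (\<lambda>y. (fst x * fst y, snd x @ snd y)) (lc_prod ys zs)"
    by (induction ys) (simp_all add: o_def mult.assoc)
  then show ?case using Cons by simp
qed simp

lemma lc_pow_letter: "lc_pow [(1, [j])] n = [(1, replicate n j)]"
  by (induction n) simp_all

lemma count_list_replicate: "count_list (replicate n j) k = (if j = k then n else 0)"
  by (induction n) auto

text \<open>The vector F_2^c |\<lambda>> is the basis vector (0, 0, c) itself, because
  \<open>gt_up\<close> equals 1 at m1 = b = 0.\<close>

lemma gt_vec_replicate_2:
  assumes "t \<notin> \<int>"
  shows "gt_vec t (replicate c 2) b = (if b = 0 then 1 else 0)"
proof (induction c arbitrary: b)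
  case (Suc c)
  have "gt_up t 0 (real c) 0 = 1"
    using nonint_shift_nz(1)[OF assms, of c 0] nonint_shift_nz(1)[OF assms, of "Suc c" 0]
    by (simp add: gt_up_def add_ac)
  then show ?case using Suc by (auto simp: opF_def count_list_replicate)
qed auto

lemma gt_vec_append_1: "gt_vec t (replicate a 1 @ w) = gt_vec t w"
  by (induction a) (simp_all add: opF_def[abs_def])

text \<open>In F_1 F_2 - F_2 F_1 the coefficient taking b - 1 to b is -(m1 - b + 1) + (m1 - b + 2) =
  1. So F_3 raises the top index by one with coefficient exactly 1.\<close>

lemma lc_vec_F3_lc:
  assumes "lc_homog m1 m2 ys"
  shows "lc_homog (Suc m1) (Suc m2) (lc_prod F3_lc ys)"
    "lc_vec t (lc_prod F3_lc ys) b = (gt_up t m1 m2 b - gt_up t (real m1 + 1) m2 b) * lc_vec t ys b + (if b = 0 then 0 else lc_vec t ys (b - 1))"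
proof -
  let ?y1 = "map (\<lambda>y. (1 * fst y, 1 # snd y)) ys" and ?y2 = "map (\<lambda>y. (1 * fst y, 2 # snd y)) ys"
  have h: "lc_homog (Suc m1) m2 ?y1" "lc_homog m1 (Suc m2) ?y2"
    using assms by (auto simp: lc_homog_def)
  have eq: "lc_prod F3_lc ys = map (\<lambda>y. (1 * fst y, 1 # snd y)) ?y2 @ map (\<lambda>y. (- 1 * fst y, 2 # snd y)) ?y1"
    by (simp add: F3_lc_def o_def)
  show "lc_homog (Suc m1) (Suc m2) (lc_prod F3_lc ys)"
    using assms by (fastforce simp: lc_homog_def F3_lc_def)
  have v: "lc_vec t ?y1 = opF t 1 m1 m2 (lc_vec t ys)" "lc_vec t ?y2 = opF t 2 m1 m2 (lc_vec t ys)"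
    by (rule ext, subst lc_vec_Cons_letter[OF assms], simp)+
  show "lc_vec t (lc_prod F3_lc ys) b = (gt_up t m1 m2 b - gt_up t (real m1 + 1) m2 b) * lc_vec t ys b + (if b = 0 then 0 else lc_vec t ys (b - 1))"
    unfolding eq lc_vec_simps lc_vec_Cons_letter[OF h(1)] lc_vec_Cons_letter[OF h(2)] v
    by (simp add: opF_def algebra_simps)
qed

lemma lc_vec_F3_F2:
  assumes t: "t \<notin> \<int>"
  defines "ys \<equiv> \<lambda>n c. lc_prod (lc_pow F3_lc n) [(1, replicate c 2)]"
  shows "lc_homog n (n + c) (ys n c) \<and> (\<forall>b>n. lc_vec t (ys n c) b = 0) \<and> lc_vec t (ys n c) n = 1"
proof (induction n)
  case 0
  then show ?case by (auto simp: ys_def gt_vec_replicate_2[OF t] count_list_replicate)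
next
  case (Suc n)
  have "ys (Suc n) c = lc_prod F3_lc (ys n c)" by (simp add: ys_def lc_prod_assoc)
  then show ?case using Suc lc_vec_F3_lc(1)[of n "n + c" "ys n c"] lc_vec_F3_lc(2)[of n "n + c" "ys n c" t] by auto
qed

text \<open>F_1 leaves coordinates indexed by b unchanged, so the triangular shape of F_3^n F_2^c
  |\<lambda>> is inherited.\<close>

lemma lc_vec_pbw:
  assumes t: "t \<notin> \<int>"
  shows "lc_homog (a + n) (n + c) (pbw a n c)" "b > n \<Longrightarrow> lc_vec t (pbw a n c) b = 0" "lc_vec t (pbw a n c) n = 1"
proof -
  let ?ys = "lc_prod (lc_pow F3_lc n) [(1, replicate c 2)]"
  have eq: "pbw a n c = map (\<lambda>y. (fst y, replicate a 1 @ snd y)) ?ys"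
    by (simp add: pbw_def lc_pow_letter)
  have v: "lc_vec t (map (\<lambda>y. (fst y, replicate a 1 @ snd y)) ys) = lc_vec t ys" for ys
    by (induction ys) (simp_all add: gt_vec_append_1[unfolded One_nat_def])
  note * = lc_vec_F3_F2[OF t, of n c]
  show "lc_homog (a + n) (n + c) (pbw a n c)"
    using * unfolding eq by (auto simp: lc_homog_def count_list_replicate)
  show "b > n \<Longrightarrow> lc_vec t (pbw a n c) b = 0" "lc_vec t (pbw a n c) n = 1"
    using * unfolding eq v by auto
qed

lemma gram_eq_gt_norm:
  fixes lam :: wt and m1 m2 :: nat
  defines "t1 \<equiv> 2 * fst lam - snd lam + 1" and "t2 \<equiv> 2 * snd lam - fst lam + 1"
  assumes t1: "t1 \<notin> \<int>"
  defines "S \<equiv> \<lambda>i. lc_vec t1 (pbw (m1 - i) i (m2 - i))"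
  assumes i: "i < Suc (min m1 m2)" and j: "j < Suc (min m1 m2)"
  shows "gram lam m1 m2 $$ (i,j) = (\<Sum>b<Suc (min m1 m2). gt_norm t1 t2 (m1 - b) b (m2 - b) * S i b * S j b)"
proof -
  have h: "lc_homog m1 m2 (pbw (m1 - k) k (m2 - k))" if "k < Suc (min m1 m2)" for k
    using lc_vec_pbw(1)[OF t1, of "m1 - k" k "m2 - k"] that by simp
  show ?thesis
    using i j shap_lc_eq_gt_form[of lam m1 m2, OF t1[unfolded t1_def] h[OF j] h[OF i]]
    by (simp add: gram_def gt_form_def S_def t1_def t2_def lessThan_Suc_atMost del: sum.lessThan_Suc)
qed

lemma det_gram_eq_gt_norm:
  fixes lam :: wt
  defines "t1 \<equiv> 2 * fst lam - snd lam + 1" and "t2 \<equiv> 2 * snd lam - fst lam + 1"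
  assumes t1: "t1 \<notin> \<int>"
  shows "det (gram lam m1 m2) = (\<Prod>b<Suc (min m1 m2). gt_norm t1 t2 (m1 - b) b (m2 - b))"
proof -
  let ?n = "Suc (min m1 m2)" and ?d = "\<lambda>b. gt_norm t1 t2 (m1 - b) b (m2 - b)"
  define S where "S = (\<lambda>i. lc_vec t1 (pbw (m1 - i) i (m2 - i)))"
  define L where "L = mat ?n ?n (\<lambda>(i,k). S i k)"
  have L: "L \<in> carrier_mat ?n ?n" by (simp add: L_def)
  have D: "mat_diag ?n ?d \<in> carrier_mat ?n ?n" by simp
  have "gram lam m1 m2 = L * mat_diag ?n ?d * transpose_mat L"
  proof (rule eq_matI)
    fix i j assume "i < dim_row (L * mat_diag ?n ?d * transpose_mat L)" "j < dim_col (L * mat_diag ?n ?d * transpose_mat L)"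
    then have ij: "i < ?n" "j < ?n" using L by auto
    have LD: "L * mat_diag ?n ?d = mat ?n ?n (\<lambda>(i,k). L $$ (i,k) * ?d k)" by (rule mat_diag_mult_right[OF L])
    show "gram lam m1 m2 $$ (i,j) = (L * mat_diag ?n ?d * transpose_mat L) $$ (i,j)"
      using gram_eq_gt_norm[of lam i m1 m2 j] t1 ij unfolding LD
      by (simp add: t1_def t2_def scalar_prod_def L_def S_def lessThan_atLeast0 mult_ac del: sum.lessThan_Suc sum.op_ivl_Suc)
  qed (simp_all add: gram_def L_def)
  moreover have "det L = 1"
  proof -
    have "det L = prod_list (diag_mat L)"
      by (rule det_lower_triangular[OF _ L]) (auto simp: L_def S_def lc_vec_pbw(2)[OF t1])
    also have "diag_mat L = map (\<lambda>i. 1) [0..<?n]"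
      unfolding diag_mat_def using L by (intro map_cong) (auto simp: L_def S_def lc_vec_pbw(3)[OF t1])
    finally show ?thesis by (simp add: map_replicate_const)
  qed
  moreover have "det (mat_diag ?n ?d) = (\<Prod>b<?n. ?d b)" by (rule det_mat_diag)
  moreover have "det (L * mat_diag ?n ?d * transpose_mat L) = det L * det (mat_diag ?n ?d) * det (transpose_mat L)"
    by (subst det_mult[of _ ?n], use L D in simp, use L D in simp, subst det_mult[OF L D]) simp
  ultimately show ?thesis using det_transpose[OF L] by simp
qed

section \<open>Perturbation off the integral weights\<close>

lemma A2_form_tendsto:
  assumes "((\<lambda>x. fst (f x)) \<longlongrightarrow> fst lam) F" "((\<lambda>x. snd (f x)) \<longlongrightarrow> snd lam) F"
  shows "((\<lambda>x. A2_form r (word_wt (f x) w)) \<longlongrightarrow> A2_form r (word_wt lam w)) F"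
  unfolding A2_form_def word_wt_def fst_conv snd_conv by (intro tendsto_intros assms)

lemma shap_tendsto:
  assumes "((\<lambda>x. fst (f x)) \<longlongrightarrow> fst lam) F" "((\<lambda>x. snd (f x)) \<longlongrightarrow> snd lam) F"
  shows "((\<lambda>x. shap (f x) u v) \<longlongrightarrow> shap lam u v) F"
proof (induction u arbitrary: v)
  case (Cons i u)
  show ?case unfolding shap.simps
  proof (intro tendsto_sum)
    fix p
    show "((\<lambda>x. if v ! p = i then A2_form (A2_root i) (word_wt (f x) (drop (Suc p) v)) * shap (f x) u (take p v @ drop (Suc p) v) else 0)
      \<longlongrightarrow> (if v ! p = i then A2_form (A2_root i) (word_wt lam (drop (Suc p) v)) * shap lam u (take p v @ drop (Suc p) v) else 0)) F"
      by (cases "v ! p = i") (auto intro!: tendsto_mult A2_form_tendsto assms Cons.IH)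
  qed
qed simp

lemma tendsto_sum_list:
  fixes g :: "'c \<Rightarrow> 'b \<Rightarrow> real"
  assumes "\<And>y. y \<in> set ys \<Longrightarrow> ((\<lambda>x. g x y) \<longlongrightarrow> h y) F"
  shows "((\<lambda>x. \<Sum>y\<leftarrow>ys. g x y) \<longlongrightarrow> (\<Sum>y\<leftarrow>ys. h y)) F"
  using assms by (induction ys) (auto intro!: tendsto_add)

lemma gram_tendsto:
  assumes "((\<lambda>x. fst (f x)) \<longlongrightarrow> fst lam) F" "((\<lambda>x. snd (f x)) \<longlongrightarrow> snd lam) F"
    and "i < Suc (min m1 m2)" "j < Suc (min m1 m2)"
  shows "((\<lambda>x. gram (f x) m1 m2 $$ (i,j)) \<longlongrightarrow> gram lam m1 m2 $$ (i,j)) F"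
  using assms(3,4) unfolding gram_def
  by (simp add: shap_lc_def) (intro tendsto_sum_list tendsto_mult tendsto_const shap_tendsto assms(1,2))

lemma det_gram_tendsto:
  assumes "((\<lambda>x. fst (f x)) \<longlongrightarrow> fst lam) F" "((\<lambda>x. snd (f x)) \<longlongrightarrow> snd lam) F"
  shows "((\<lambda>x. det (gram (f x) m1 m2)) \<longlongrightarrow> det (gram lam m1 m2)) F"
proof -
  have c: "gram l m1 m2 \<in> carrier_mat (Suc (min m1 m2)) (Suc (min m1 m2))" for l by (simp add: gram_def)
  have perm: "p i < Suc (min m1 m2)" if "p permutes {0..<Suc (min m1 m2)}" "i < Suc (min m1 m2)" for p i
    using permutes_in_image[OF that(1), of i] that(2) by simp
  show ?thesis unfolding det_def'[OF c]
    by (intro tendsto_sum tendsto_mult tendsto_const tendsto_prod gram_tendsto assms) (simp_all add: perm)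
qed

section \<open>Signs of the norms\<close>

lemma flip_sign_Suc_le: "A \<le> n \<Longrightarrow> flip_sign (Suc n) A = - flip_sign n A"
  by (auto simp: flip_sign_def Suc_diff_le)

lemma sgn_falling:
  "(\<And>i. i < n \<Longrightarrow> s \<noteq> real (Suc i)) \<Longrightarrow> sgn (falling s n) = real_of_int (flip_sign n (nat \<lfloor>s\<rfloor>))"
proof (induction n)
  case (Suc n)
  have IH: "sgn (falling s n) = real_of_int (flip_sign n (nat \<lfloor>s\<rfloor>))" using Suc by simp
  have ne: "s \<noteq> real (Suc n)" using Suc.prems by blast
  show ?case
  proof (cases "s > real (Suc n)")
    case True
    then have "Suc n \<le> nat \<lfloor>s\<rfloor>" by (simp add: le_nat_iff le_floor_iff)
    then show ?thesis using IH True by (simp add: falling_Suc sgn_mult flip_sign_def)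
  next
    case False
    then have "s < real n + 1" using ne by simp
    then have "nat \<lfloor>s\<rfloor> \<le> n" by linarith
    then show ?thesis using IH \<open>s < real n + 1\<close> by (simp add: falling_Suc sgn_mult flip_sign_Suc_le)
  qed
qed simp

lemma sgn_gt_norm:
  assumes t1: "t1 \<notin> \<int>" and t2: "\<And>i. t2 \<noteq> real (Suc i)" and t3: "\<And>i. t1 + t2 \<noteq> real (Suc i)"
  shows "sgn (gt_norm t1 t2 a b c) = real_of_int (gt_sign \<lfloor>t1\<rfloor> (nat \<lfloor>t2\<rfloor>) (nat \<lfloor>t1 + t2\<rfloor>) (a + b) b c)"
proof -
  let ?r = "t1 + real c + 1" and ?s = "t1 - real b + real c"
  have ne: "t1 + real c + 1 \<noteq> real (Suc i)" for i
    using nonint_shift_nz(1)[OF t1, of c i] by auto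
  have ne': "t1 \<noteq> real (Suc i)" for i using t1 by auto
  have e: "?r - real b - 1 = ?s" by simp
  \<comment> \<open>The factors are those of \<open>falling ?r b\<close>, then ?s, then those of
    \<open>falling ?s a\<close>. The quotient in the norm thus has the sign of this product times
    that of ?s, which explains \<open>Suc m1\<close> and the comparison of b with n1 + c in
    \<open>gt_sign\<close>.\<close>
  have "falling ?r (Suc (a + b)) = falling ?r (b + Suc a)" by (simp add: add.commute)
  also have "\<dots> = falling ?r b * (falling (?r - real b) 1 * falling ?s a)"
    unfolding falling_add using falling_add[of "?r - real b" 1 a] e by simp
  finally have f: "falling ?r (Suc (a + b)) = falling ?r b * (?s * falling ?s a)"
    by (simp add: falling_Suc algebra_simps)
  have nz: "?s \<noteq> 0" using nonint_shift_nz(1)[OF t1, of c b] by (simp add: algebra_simps)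
  have "sgn (falling ?s a / falling ?r b) = sgn ?s * sgn (falling ?r (Suc (a + b)))"
    unfolding f using nz by (simp add: sgn_mult sgn_divide)
  also have "sgn (falling ?r (Suc (a + b))) = real_of_int (flip_sign (Suc (a + b)) (nat \<lfloor>?r\<rfloor>))"
    by (rule sgn_falling) (rule ne)
  also have "\<lfloor>?r\<rfloor> = \<lfloor>t1\<rfloor> + int c + 1" by linarith
  also have "sgn ?s = (if int b \<le> \<lfloor>t1\<rfloor> + int c then 1 else - 1)"
  proof (cases "int b \<le> \<lfloor>t1\<rfloor> + int c")
    case True
    then have "?s \<ge> 0" by linarith
    then show ?thesis using True nz by simp
  next
    case False
    then have "?s < 0" by linarith
    then show ?thesis using False by simp
  qed
  finally have 1: "sgn (falling ?s a / falling ?r b) = (if int b \<le> \<lfloor>t1\<rfloor> + int c then 1 else - 1) *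
    real_of_int (flip_sign (Suc (a + b)) (nat (\<lfloor>t1\<rfloor> + int c + 1)))" .
  have "gt_norm t1 t2 a b c = (fact a * fact b * fact c) * (falling ?s a / falling ?r b) * falling (t1 + t2) b * falling t1 b * falling t2 c"
    by (simp add: gt_norm_def)
  then have "sgn (gt_norm t1 t2 a b c) = sgn (fact a * fact b * fact c) * sgn (falling ?s a / falling ?r b) *
      sgn (falling (t1 + t2) b) * sgn (falling t1 b) * sgn (falling t2 c)"
    by (simp only: sgn_mult)
  moreover have "sgn (fact a * fact b * fact c :: real) = 1" by (simp add: sgn_mult)
  ultimately show ?thesis
    unfolding 1 gt_sign_def sgn_falling[OF t2] sgn_falling[OF t3] sgn_falling[OF ne'] by simp
qed

lemma abs_gt_sign: "\<bar>gt_sign n1 a2 a3 m1 b c\<bar> = 1"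
  by (simp add: gt_sign_def abs_mult flip_sign_def power_abs)

section \<open>Cancellation in the determinant\<close>

lemma falling_eq_prod_int: "falling (t + of_int s) n = (\<Prod>k\<in>{s - int n..s - 1}. t + of_int k)"
proof (induction n)
  case (Suc n)
  have "{s - int (Suc n)..s - 1} = insert (s - int n - 1) {s - int n..s - 1}" by auto
  then show ?case using Suc by (simp add: falling_Suc algebra_simps)
qed simp


text \<open>The factors \<open>t + k\<close> with \<open>k \<ge> 0\<close> in the numerators and the denominators of the norms cancel
in their product: the reflection \<open>b \<mapsto> m2 - k - b\<close> exchanges them.\<close>

lemma prod_falling_ratio:
  fixes m1 m2 :: nat
  defines "N \<equiv> SIGMA b : {..min m1 m2}. {int m2 - int b - int m1..int m2 - 2 * int b - 1}"
    and "D \<equiv> SIGMA b : {..min m1 m2}. {int m2 - 2 * int b + 1..int m2 - int b}"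
  assumes t: "t \<notin> \<int>"
  shows "(\<Prod>b\<le>min m1 m2. falling (t - real b + real (m2 - b)) (m1 - b) / falling (t + real (m2 - b) + 1) b) =
    (\<Prod>(b, k)\<in>{(b, k) \<in> N. k < 0}. t + of_int k) / (\<Prod>(b, k)\<in>{(b, k) \<in> D. k < 0}. t + of_int k)"
proof -
  have nz: "t + of_int k \<noteq> 0" for k
    using t by (metis Ints_minus Ints_of_int add.inverse_inverse add_eq_0_iff)
  have fin: "finite N" "finite D" by (simp_all add: N_def D_def)
  have split: "(\<Prod>(b, k)\<in>M. t + of_int k) = (\<Prod>(b, k)\<in>{(b, k) \<in> M. k \<ge> 0}. t + of_int k) * (\<Prod>(b, k)\<in>{(b, k) \<in> M. k < 0}. t + of_int k)"
    if "finite M" for M :: "(nat \<times> int) set"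
  proof -
    have "M = {(b, k) \<in> M. k \<ge> 0} \<union> {(b, k) \<in> M. k < 0}" by auto
    then have "(\<Prod>(b, k)\<in>M. t + of_int k) = (\<Prod>(b, k)\<in>{(b, k) \<in> M. k \<ge> 0} \<union> {(b, k) \<in> M. k < 0}. t + of_int k)" by simp
    also have "\<dots> = (\<Prod>(b, k)\<in>{(b, k) \<in> M. k \<ge> 0}. t + of_int k) * (\<Prod>(b, k)\<in>{(b, k) \<in> M. k < 0}. t + of_int k)"
      by (rule prod.union_disjoint) (auto intro: finite_subset[OF _ that])
    finally show ?thesis .
  qed
  have "(\<Prod>b\<le>min m1 m2. falling (t - real b + real (m2 - b)) (m1 - b)) = (\<Prod>b\<le>min m1 m2. \<Prod>k\<in>{int m2 - int b - int m1..int m2 - 2 * int b - 1}. t + of_int k)"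
  proof (intro prod.cong refl)
    fix b assume "b \<in> {..min m1 m2}"
    then have "t - real b + real (m2 - b) = t + of_int (int m2 - 2 * int b)" "int m2 - 2 * int b - int (m1 - b) = int m2 - int b - int m1"
      by (simp_all add: of_nat_diff)
    note E = this
    show "falling (t - real b + real (m2 - b)) (m1 - b) = (\<Prod>k\<in>{int m2 - int b - int m1..int m2 - 2 * int b - 1}. t + of_int k)"
      using falling_eq_prod_int[of t "int m2 - 2 * int b" "m1 - b"] unfolding E .
  qed
  also have "\<dots> = (\<Prod>(b, k)\<in>N. t + of_int k)" unfolding N_def by (rule prod.Sigma) auto
  finally have num: "(\<Prod>b\<le>min m1 m2. falling (t - real b + real (m2 - b)) (m1 - b)) = (\<Prod>(b, k)\<in>N. t + of_int k)" .
  have "(\<Prod>b\<le>min m1 m2. falling (t + real (m2 - b) + 1) b) = (\<Prod>b\<le>min m1 m2. \<Prod>k\<in>{int m2 - 2 * int b + 1..int m2 - int b}. t + of_int k)"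
  proof (intro prod.cong refl)
    fix b assume "b \<in> {..min m1 m2}"
    then have "t + real (m2 - b) + 1 = t + of_int (int m2 - int b + 1)" "int m2 - int b + 1 - int b = int m2 - 2 * int b + 1"
      by (simp_all add: of_nat_diff)
    note E = this
    show "falling (t + real (m2 - b) + 1) b = (\<Prod>k\<in>{int m2 - 2 * int b + 1..int m2 - int b}. t + of_int k)"
      using falling_eq_prod_int[of t "int m2 - int b + 1" b] unfolding E add_diff_cancel_right' .
  qed
  also have "\<dots> = (\<Prod>(b, k)\<in>D. t + of_int k)" unfolding D_def by (rule prod.Sigma) auto
  finally have den: "(\<Prod>b\<le>min m1 m2. falling (t + real (m2 - b) + 1) b) = (\<Prod>(b, k)\<in>D. t + of_int k)" .
  have "(\<Prod>(b, k)\<in>{(b, k) \<in> N. k \<ge> 0}. t + of_int k) = (\<Prod>(b, k)\<in>{(b, k) \<in> D. k \<ge> 0}. t + of_int k)"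
    by (rule prod.reindex_bij_witness[of _ "\<lambda>(b, k). (nat (int m2 - k - int b), k)" "\<lambda>(b, k). (nat (int m2 - k - int b), k)"])
      (auto simp: N_def D_def)
  \<comment> \<open>Pairs in \<open>N\<close> satisfy b < m2 - k - b and pairs in \<open>D\<close>
    satisfy b > m2 - k - b; for k \<ge> 0 the reflected index stays in range.\<close>
  moreover have "(\<Prod>(b, k)\<in>{(b, k) \<in> D. k \<ge> 0}. t + of_int k) \<noteq> 0"
    using nz by (subst prod_zero_iff) (auto intro: finite_subset[OF _ fin(2)])
  ultimately show ?thesis
    unfolding prod_dividef num den split[OF fin(1)] split[OF fin(2)] by simp
qed

lemma prod_gt_norm:
  fixes m1 m2 :: nat
  defines "N \<equiv> SIGMA b : {..min m1 m2}. {int m2 - int b - int m1..int m2 - 2 * int b - 1}"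
    and "D \<equiv> SIGMA b : {..min m1 m2}. {int m2 - 2 * int b + 1..int m2 - int b}"
  assumes t: "t1 \<notin> \<int>"
  shows "(\<Prod>b<Suc (min m1 m2). gt_norm t1 t2 (m1 - b) b (m2 - b)) =
    (\<Prod>b\<le>min m1 m2. fact (m1 - b) * fact b * fact (m2 - b) * falling (t1 + t2) b * falling t1 b * falling t2 (m2 - b)) *
    ((\<Prod>(b, k)\<in>{(b, k) \<in> N. k < 0}. t1 + of_int k) / (\<Prod>(b, k)\<in>{(b, k) \<in> D. k < 0}. t1 + of_int k))"
  unfolding N_def D_def prod_falling_ratio[OF t, symmetric] prod.distrib[symmetric] lessThan_Suc_atMost
  by (intro prod.cong refl) (simp add: gt_norm_def)

section \<open>Passage to the limit from non-integral weights\<close>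

lemma eventually_floor_right:
  fixes t :: real
  shows "\<forall>\<^sub>F \<delta> in at_right 0. t + \<delta> \<notin> \<int> \<and> \<lfloor>t + \<delta>\<rfloor> = \<lfloor>t\<rfloor>"
  unfolding eventually_at_right_field
proof (intro exI[of _ "of_int \<lfloor>t\<rfloor> + 1 - t"] conjI allI impI)
  show "0 < real_of_int \<lfloor>t\<rfloor> + 1 - t" by linarith
  fix \<delta> :: real assume \<delta>: "\<delta> > 0" "\<delta> < of_int \<lfloor>t\<rfloor> + 1 - t"
  then show fl: "\<lfloor>t + \<delta>\<rfloor> = \<lfloor>t\<rfloor>" by linarith
  show "t + \<delta> \<notin> \<int>"
  proof
    assume "t + \<delta> \<in> \<int>"
    then obtain z where "t + \<delta> = of_int z" by (rule Ints_cases)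
    then show False using fl \<delta> by (metis add_strict_increasing2 floor_of_int le_less_trans less_add_same_cancel1 not_less of_int_floor_le)
  qed
qed

definition wt_shift :: "wt \<Rightarrow> real \<Rightarrow> wt" where
  "wt_shift lam \<delta> = (fst lam + 2 / 3 * \<delta>, snd lam + 1 / 3 * \<delta>)"

lemma wt_shift_tendsto:
  "((\<lambda>\<delta>. fst (wt_shift lam \<delta>)) \<longlongrightarrow> fst lam) (at_right 0)"
  "((\<lambda>\<delta>. snd (wt_shift lam \<delta>)) \<longlongrightarrow> snd lam) (at_right 0)"
proof -
  have "((\<lambda>\<delta>::real. fst lam + 2 / 3 * \<delta>) \<longlongrightarrow> fst lam + 2 / 3 * 0) (at_right 0)" by (intro tendsto_intros)
  moreover have "((\<lambda>\<delta>::real. snd lam + 1 / 3 * \<delta>) \<longlongrightarrow> snd lam + 1 / 3 * 0) (at_right 0)" by (intro tendsto_intros)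
  ultimately show "((\<lambda>\<delta>. fst (wt_shift lam \<delta>)) \<longlongrightarrow> fst lam) (at_right 0)"
    "((\<lambda>\<delta>. snd (wt_shift lam \<delta>)) \<longlongrightarrow> snd lam) (at_right 0)" by (simp_all add: wt_shift_def)
qed

lemma wt_shift_coords:
  "2 * fst (wt_shift lam \<delta>) - snd (wt_shift lam \<delta>) + 1 = (2 * fst lam - snd lam + 1) + \<delta>"
  "2 * snd (wt_shift lam \<delta>) - fst (wt_shift lam \<delta>) + 1 = 2 * snd lam - fst lam + 1"
  by (simp_all add: wt_shift_def)

text \<open>The recursion of \<open>shap\<close> treats its arguments asymmetrically. Symmetry is
  visible from the diagonal form at non-integral \<open>t1\<close> and passes to the limit.\<close>

lemma symmetric_gram: "transpose_mat (gram lam m1 m2) = gram lam m1 m2"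
proof (rule eq_matI)
  fix i j assume "i < dim_row (gram lam m1 m2)" "j < dim_col (gram lam m1 m2)"
  then have ij: "i < Suc (min m1 m2)" "j < Suc (min m1 m2)" by (simp_all add: gram_def)
  let ?f = "wt_shift lam"
  have "\<forall>\<^sub>F \<delta> in at_right 0. gram (?f \<delta>) m1 m2 $$ (j,i) = gram (?f \<delta>) m1 m2 $$ (i,j)"
    using eventually_floor_right[of "2 * fst lam - snd lam + 1"]
  proof eventually_elim
    case (elim \<delta>)
    then have "2 * fst (?f \<delta>) - snd (?f \<delta>) + 1 \<notin> \<int>" unfolding wt_shift_coords by blast
    from gram_eq_gt_norm[OF this ij] gram_eq_gt_norm[OF this ij(2,1)] show ?case by (simp only: mult.assoc mult.commute mult.left_commute)
  qed
  then have "((\<lambda>\<delta>. gram (?f \<delta>) m1 m2 $$ (i,j)) \<longlongrightarrow> gram lam m1 m2 $$ (j,i)) (at_right 0)"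
    using gram_tendsto[OF wt_shift_tendsto ij(2,1)] by (rule Lim_transform_eventually[rotated])
  then have "gram lam m1 m2 $$ (j,i) = gram lam m1 m2 $$ (i,j)"
    using tendsto_unique[OF trivial_limit_at_right_real _ gram_tendsto[OF wt_shift_tendsto ij]] by blast
  then show "transpose_mat (gram lam m1 m2) $$ (i,j) = gram lam m1 m2 $$ (i,j)"
    using ij by (simp add: gram_def)
qed (simp_all add: gram_def)

lemma tendsto_falling: "(f \<longlongrightarrow> s) F \<Longrightarrow> ((\<lambda>x. falling (f x) n) \<longlongrightarrow> falling s n) F"
  unfolding falling_def by (intro tendsto_intros)

lemma det_gram_nonzero:
  fixes lam :: wt
  defines "t1 \<equiv> 2 * fst lam - snd lam + 1" and "t2 \<equiv> 2 * snd lam - fst lam + 1"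
  assumes t1: "\<And>i. t1 \<noteq> real (Suc i)" and t2: "\<And>i. t2 \<noteq> real (Suc i)" and t3: "\<And>i. t1 + t2 \<noteq> real (Suc i)"
  shows "det (gram lam m1 m2) \<noteq> 0"
proof -
  let ?f = "wt_shift lam"
  let ?N = "{(b, k) \<in> (SIGMA b : {..min m1 m2}. {int m2 - int b - int m1..int m2 - 2 * int b - 1}). k < 0}"
  let ?D = "{(b, k) \<in> (SIGMA b : {..min m1 m2}. {int m2 - 2 * int b + 1..int m2 - int b}). k < 0}"
  \<comment> \<open>The determinant after cancellation; unlike the product of the norms it is
    continuous at t1.\<close>
  define G where "G t = (\<Prod>b\<le>min m1 m2. fact (m1 - b) * fact b * fact (m2 - b) * falling (t + t2) b * falling t b * falling t2 (m2 - b)) *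
    ((\<Prod>(b, k)\<in>?N. t + of_int k) / (\<Prod>(b, k)\<in>?D. t + of_int k))" for t
  have fin: "finite ?N" "finite ?D"
    by (rule finite_subset[of _ "SIGMA b : {..min m1 m2}. {int m2 - int b - int m1..int m2 - 2 * int b - 1}"], auto)
      (rule finite_subset[of _ "SIGMA b : {..min m1 m2}. {int m2 - 2 * int b + 1..int m2 - int b}"], auto)
  \<comment> \<open>For k < 0 such a factor could vanish only at a positive integer t1, which lies
    on a vanishing line of the first simple root.\<close>
  have neg: "t1 + of_int k \<noteq> 0" if "k < 0" for k
    using t1[of "nat (- k - 1)"] that by (auto simp: add_eq_0_iff)
  have nz: "(\<Prod>(b, k)\<in>?N. t1 + of_int k) \<noteq> 0" "(\<Prod>(b, k)\<in>?D. t1 + of_int k) \<noteq> 0"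
    unfolding prod_zero_iff[OF fin(1)] prod_zero_iff[OF fin(2)] using neg by auto
  have "G t1 \<noteq> 0"
    unfolding G_def using nz falling_nz[OF t1] falling_nz[OF t2] falling_nz[OF t3] by (simp add: prod_zero_iff)
  have shift: "((\<lambda>\<delta>. t1 + \<delta>) \<longlongrightarrow> t1) (at_right 0)"
    using tendsto_add[OF tendsto_const[of t1] tendsto_ident_at[of 0 "{0<..}"]] by simp
  have "((\<lambda>\<delta>. G (t1 + \<delta>)) \<longlongrightarrow> G t1) (at_right 0)"
    unfolding G_def
    by (intro tendsto_mult tendsto_divide tendsto_prod tendsto_const tendsto_falling tendsto_add shift nz)
      (auto simp: case_prod_beta intro!: tendsto_add shift)
  moreover have "\<forall>\<^sub>F \<delta> in at_right 0. G (t1 + \<delta>) = det (gram (?f \<delta>) m1 m2)"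
    using eventually_floor_right[of t1]
  proof eventually_elim
    case (elim \<delta>)
    then have n: "t1 + \<delta> \<notin> \<int>" by blast
    show ?case
      using det_gram_eq_gt_norm[of "?f \<delta>" m1 m2, unfolded wt_shift_coords, folded t1_def t2_def, OF n]
        prod_gt_norm[OF n, where ?m1.0 = m1 and ?m2.0 = m2 and ?t2.0 = t2]
      unfolding G_def by simp
  qed
  ultimately have "((\<lambda>\<delta>. det (gram (?f \<delta>) m1 m2)) \<longlongrightarrow> G t1) (at_right 0)"
    by (rule Lim_transform_eventually)
  then have "det (gram lam m1 m2) = G t1"
    using tendsto_unique[OF trivial_limit_at_right_real det_gram_tendsto[OF wt_shift_tendsto]] by blast
  then show ?thesis using \<open>G t1 \<noteq> 0\<close> by simp
qed

theorem sig_gram: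
  fixes lam :: wt
  defines "t1 \<equiv> 2 * fst lam - snd lam + 1" and "t2 \<equiv> 2 * snd lam - fst lam + 1"
  assumes t1: "\<And>i. t1 \<noteq> real (Suc i)" and t2: "\<And>i. t2 \<noteq> real (Suc i)" and t3: "\<And>i. t1 + t2 \<noteq> real (Suc i)"
  shows "sig (gram lam m1 m2) = gt_sum \<lfloor>t1\<rfloor> (nat \<lfloor>t2\<rfloor>) (nat \<lfloor>t1 + t2\<rfloor>) m1 m2"
proof -
  let ?n = "Suc (min m1 m2)" and ?f = "wt_shift lam"
  let ?s = "\<lambda>b. gt_sign \<lfloor>t1\<rfloor> (nat \<lfloor>t2\<rfloor>) (nat \<lfloor>t1 + t2\<rfloor>) m1 b (m2 - b)"
  have "sig (gram lam m1 m2) = (\<Sum>b<?n. ?s b)"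
  proof (rule sig_eq_approx_congruent)
    show "gram lam m1 m2 \<in> carrier_mat ?n ?n" by (simp add: gram_def)
    show "transpose_mat (gram lam m1 m2) = gram lam m1 m2" by (rule symmetric_gram)
    show "det (gram lam m1 m2) \<noteq> 0"
      using t1 t2 t3 unfolding t1_def t2_def by (rule det_gram_nonzero)
    show "\<bar>?s k\<bar> = 1" for k by (rule abs_gt_sign)
    fix \<epsilon> :: real assume "\<epsilon> > 0"
    have "\<forall>\<^sub>F \<delta> in at_right 0. \<forall>i\<in>{..<?n}. \<forall>j\<in>{..<?n}. \<bar>gram (?f \<delta>) m1 m2 $$ (i,j) - gram lam m1 m2 $$ (i,j)\<bar> < \<epsilon>"
    proof (intro eventually_ball_finite ballI finite_lessThan)
      fix i j assume "i \<in> {..<?n}" "j \<in> {..<?n}"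
      then show "\<forall>\<^sub>F \<delta> in at_right 0. \<bar>gram (?f \<delta>) m1 m2 $$ (i,j) - gram lam m1 m2 $$ (i,j)\<bar> < \<epsilon>"
        using tendstoD[OF gram_tendsto[OF wt_shift_tendsto, of i m1 m2 j lam] \<open>\<epsilon> > 0\<close>] by (simp add: dist_real_def)
    qed
    \<comment> \<open>The sum t1 + t2 may be an integer that is not positive, so its shift is kept
      off the integers as well; the three floors do not change.\<close>
    then have "\<forall>\<^sub>F \<delta> in at_right 0. (\<forall>i\<in>{..<?n}. \<forall>j\<in>{..<?n}. \<bar>gram (?f \<delta>) m1 m2 $$ (i,j) - gram lam m1 m2 $$ (i,j)\<bar> < \<epsilon>) \<and>
      (t1 + \<delta> \<notin> \<int> \<and> \<lfloor>t1 + \<delta>\<rfloor> = \<lfloor>t1\<rfloor>) \<and> (t1 + t2 + \<delta> \<notin> \<int> \<and> \<lfloor>t1 + t2 + \<delta>\<rfloor> = \<lfloor>t1 + t2\<rfloor>)"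
      by (intro eventually_conj eventually_floor_right)
    from eventually_happens'[OF trivial_limit_at_right_real this]
    obtain \<delta> where elim: "\<forall>i\<in>{..<?n}. \<forall>j\<in>{..<?n}. \<bar>gram (?f \<delta>) m1 m2 $$ (i,j) - gram lam m1 m2 $$ (i,j)\<bar> < \<epsilon>"
      "t1 + \<delta> \<notin> \<int>" "\<lfloor>t1 + \<delta>\<rfloor> = \<lfloor>t1\<rfloor>" "t1 + t2 + \<delta> \<notin> \<int>" "\<lfloor>t1 + t2 + \<delta>\<rfloor> = \<lfloor>t1 + t2\<rfloor>" by blast
    show "\<exists>S d. (\<forall>k<?n. sgn (d k) = real_of_int (?s k)) \<and>
      (\<forall>i<?n. \<forall>j<?n. \<bar>gram lam m1 m2 $$ (i,j) - (\<Sum>k<?n. d k * S i k * S j k)\<bar> \<le> \<epsilon>)"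
    proof -
      let ?t = "t1 + \<delta>"
      define S where "S = (\<lambda>i. lc_vec ?t (pbw (m1 - i) i (m2 - i)))"
      define d where "d = (\<lambda>b. gt_norm ?t t2 (m1 - b) b (m2 - b))"
      have n: "?t \<notin> \<int>" "\<lfloor>?t\<rfloor> = \<lfloor>t1\<rfloor>" using elim by auto
      have n3: "?t + t2 \<notin> \<int>" "\<lfloor>?t + t2\<rfloor> = \<lfloor>t1 + t2\<rfloor>" using elim by (auto simp: add_ac)
      have "sgn (d k) = real_of_int (?s k)" if "k < ?n" for k
        using sgn_gt_norm[OF n(1) t2, of "m1 - k" k "m2 - k"] n3 that unfolding d_def n(2) n3(2)
        by fastforce
      moreover have "gram (?f \<delta>) m1 m2 $$ (i,j) = (\<Sum>k<?n. d k * S i k * S j k)" if "i < ?n" "j < ?n" for i j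
        using gram_eq_gt_norm[of "?f \<delta>" i m1 m2 j, unfolded wt_shift_coords, folded t1_def t2_def, OF n(1) that]
        unfolding S_def d_def .
      ultimately show ?thesis using elim(1)
        by (intro exI[of _ S] exI[of _ d]) (auto simp: abs_minus_commute intro!: less_imp_le)
    qed
  qed
  then show ?thesis by (simp add: gt_sum_def lessThan_Suc_atMost del: sum.lessThan_Suc)
qed

theorem theorem7:
  fixes lam :: wt
  assumes "lam \<in> regR"
  shows "sig_char lam * A2_denom = ftilde (a_coord 1 lam) (a_coord 2 lam) (a_coord 3 lam)"
proof -
  let ?t1 = "2 * fst lam - snd lam + 1" and ?t2 = "2 * snd lam - fst lam + 1"
  have form: "A2_form (A2_root 1) (wt_add lam A2_rho) = ?t1" "A2_form (A2_root 2) (wt_add lam A2_rho) = ?t2"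
    "A2_form (A2_root 3) (wt_add lam A2_rho) = ?t1 + ?t2"
    by (simp_all add: A2_form_def A2_root_def wt_add_def A2_rho_def algebra_simps)
  have reg: "A2_form (A2_root i) (wt_add lam A2_rho) \<noteq> real (Suc k)" if "i \<in> {1, 2, 3}" for i k
  proof -
    have "lam \<notin> vanishing_line (Suc k) i" using assms that unfolding regR_def A2_pos_roots_def by fastforce
    then show ?thesis by (simp add: vanishing_line_def)
  qed
  have "sig (gram lam m1 m2) = gt_sum \<lfloor>?t1\<rfloor> (nat \<lfloor>?t2\<rfloor>) (nat \<lfloor>?t1 + ?t2\<rfloor>) m1 m2" for m1 m2
    using reg[of 1] reg[of 2] reg[of 3] unfolding form by (intro sig_gram) simp_all
  then have "sig_char lam = gt_char \<lfloor>?t1\<rfloor> (nat \<lfloor>?t2\<rfloor>) (nat \<lfloor>?t1 + ?t2\<rfloor>)"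
    by (simp add: sig_char_def gt_char_def)
  then show ?thesis using gt_char_eq[of ?t1 ?t2] by (simp only: a_coord_def form)
qed

end
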